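(* Let $f\in L^1_{loc}([0,\infty);\mathbb{R})$, let $a>0$ and $b>0$ be real constants, and for $(\xi_0,\xi_1)\in\mathbb{R}^2$ let $x(\cdot;\xi_0,\xi_1)$ be the unique continuous solution on $[0,\infty)$ of $$x''(t)+ax'(t)+bx(t)=f(t),\quad t\ge 0;\qquad x(0)=\xi_0,\ x'(0)=\xi_1.$$ Let $$y_2(t)=\int_0^t (t-s)e^{-(t-s)}f(s)\,ds,\qquad F_{(\theta_1,\theta_2)}(t)=\int_{(t-\theta_1)^+}^t\int_{(s-\theta_2)^+}^s f(u)\,du\,ds,\qquad t\ge 0,\ \theta_1,\theta_2\in[0,1].$$ Then the following are equivalent: (i) For every $(\xi_0,\xi_1)\in\mathbb{R}^2$, $x(t;\xi_0,\xi_1)\to 0$ as $t\to\infty$; (ii) $y_2(t)\to 0$ as $t\to\infty$; (iii) $F_{(\theta_1,\theta_2)}(t)\to 0$ as $t\to\infty$ uniformly in $(\theta_1,\theta_2)\in[0,1]^2$; (iv) $F_{(\theta_1,\theta_2)}(t)\to 0$ as $t\to\infty$ for each $(\theta_1,\theta_2)\in[0,1]^2$.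
   Context: $u^+=\max(u,0)$. Since $f$ is only locally integrable, a solution of the differential equation is a function $x\in C^1([0,\infty);\mathbb{R})$ with $x'$ locally absolutely continuous, satisfying the equation for almost every $t\ge 0$ and the given initial conditions. *)

theory Defs
  imports "HOL-Analysis.Analysis"
begin

text \<open>Absolute continuity on a compact interval, in the usual epsilon-delta form; a finite system
  of non-overlapping subintervals is represented by the set of its pairs of endpoints.\<close>

definition abs_continuous_on_interval :: "real \<Rightarrow> real \<Rightarrow> (real \<Rightarrow> real) \<Rightarrow> bool" where
  "abs_continuous_on_interval c d g \<longleftrightarrow>
     (\<forall>\<epsilon>>0. \<exists>\<delta>>0. \<forall>D :: (real \<times> real) set.
        finite D \<and> (\<forall>(r, s)\<in>D. c \<le> r \<and> r \<le> s \<and> s \<le> d) \<and>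
        disjoint_family_on (\<lambda>(r, s). {r<..<s}) D \<and> (\<Sum>(r, s)\<in>D. s - r) < \<delta> \<longrightarrow>
        (\<Sum>(r, s)\<in>D. \<bar>g s - g r\<bar>) < \<epsilon>)"

definition locally_abs_continuous :: "(real \<Rightarrow> real) \<Rightarrow> bool" where
  "locally_abs_continuous g \<longleftrightarrow> (\<forall>T\<ge>0. abs_continuous_on_interval 0 T g)"

definition L1_loc :: "(real \<Rightarrow> real) \<Rightarrow> bool" where
  "L1_loc f \<longleftrightarrow> (\<forall>T\<ge>0. set_integrable lebesgue {0..T} f)"

text \<open>In the following, \<open>v\<close> is the derivative of \<open>x\<close> and \<open>w\<close> is the value at \<open>t\<close> of the second
  derivative; derivatives at 0 are one-sided. Values of the functions at negative arguments are
  irrelevant.\<close>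

definition is_ode_solution ::
  "real \<Rightarrow> real \<Rightarrow> (real \<Rightarrow> real) \<Rightarrow> real \<Rightarrow> real \<Rightarrow> (real \<Rightarrow> real) \<Rightarrow> bool" where
  "is_ode_solution a b f \<xi>0 \<xi>1 x \<longleftrightarrow>
     (\<exists>v. (\<forall>t\<ge>0. (x has_real_derivative v t) (at t within {0..})) \<and>
          continuous_on {0..} v \<and> locally_abs_continuous v \<and>
          (AE t in lebesgue. t \<ge> 0 \<longrightarrow>
             (\<exists>w. (v has_real_derivative w) (at t within {0..}) \<and> w + a * v t + b * x t = f t)) \<and>
          x 0 = \<xi>0 \<and> v 0 = \<xi>1)"

text \<open>The solution is unique only as a function on \<open>[0,\<infinity>)\<close>; being extensional pins it down
  as a total function, so that the definite description is meaningful.\<close>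

definition ode_solution ::
  "real \<Rightarrow> real \<Rightarrow> (real \<Rightarrow> real) \<Rightarrow> real \<Rightarrow> real \<Rightarrow> real \<Rightarrow> real" where
  "ode_solution a b f \<xi>0 \<xi>1 = (THE x. x \<in> extensional {0..} \<and> is_ode_solution a b f \<xi>0 \<xi>1 x)"

definition y2 :: "(real \<Rightarrow> real) \<Rightarrow> real \<Rightarrow> real" where
  "y2 f t = (LINT s:{0..t}|lebesgue. (t - s) * exp (- (t - s)) * f s)"

definition F :: "(real \<Rightarrow> real) \<Rightarrow> real \<times> real \<Rightarrow> real \<Rightarrow> real" where
  "F f = (\<lambda>(\<theta>1, \<theta>2) t.
     LINT s:{max (t - \<theta>1) 0..t}|lebesgue. LINT u:{max (s - \<theta>2) 0..s}|lebesgue. f u)"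

end

theory Submission
  imports Defs
begin

text \<open>Let \<open>G\<close> and \<open>H\<close> be the first and second primitives of \<open>f\<close>, and \<open>\<Delta>\<^sub>p K t = K t - K (t - p)\<close>. In terms
  of \<open>z = x' + a x - G\<close> the equation becomes the linear system \<open>x' = z - a x + G\<close>, \<open>z' = - b x\<close> with
  continuous input; \<open>y\<^sub>2\<close> solves the one for \<open>a = 2\<close>, \<open>b = 1\<close>. For \<open>t \<ge> 2\<close> the quantity
  \<open>F (\<theta>\<^sub>1, \<theta>\<^sub>2) t\<close> is the second difference \<open>\<Delta>\<^sub>p \<Delta>\<^sub>q H t\<close> with \<open>p = \<theta>\<^sub>1\<close>, \<open>q = \<theta>\<^sub>2\<close>, so it suffices to show
  for every solution of every such system with \<open>a, b > 0\<close> that \<open>x\<close> vanishes at infinity iff the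
  second differences of \<open>H\<close> do, uniformly or pointwise.

  If \<open>x \<longlongrightarrow> 0\<close>, the mean value theorem applied to \<open>H - x\<close>, whose derivative is \<open>a x - z\<close>, bounds the
  second differences. Conversely, averaging them over unit intervals splits \<open>H\<close> into a vanishing
  part and parts whose first or second derivatives vanish at infinity; since the homogeneous system
  is exponentially stable, \<open>x \<longlongrightarrow> 0\<close>. Pointwise convergence implies uniform convergence by Baire's
  theorem, as for slowly varying functions.\<close>

section \<open>Absolute continuity\<close>

text \<open>The closure properties below reduce to this comparison: a system whose length is below
  both deltas has small total increments for \<open>g\<close> and \<open>h\<close>, hence for
  \<open>k\<close>.\<close>

lemma abs_continuous_on_interval_dominated:
  assumes "abs_continuous_on_interval c d g" "abs_continuous_on_interval c d h" "M \<ge> 0"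
    and bound: "\<And>r s. c \<le> r \<Longrightarrow> r \<le> s \<Longrightarrow> s \<le> d \<Longrightarrow> \<bar>k s - k r\<bar> \<le> M * (\<bar>g s - g r\<bar> + \<bar>h s - h r\<bar>)"
  shows "abs_continuous_on_interval c d k"
  unfolding abs_continuous_on_interval_def
proof (intro allI impI)
  fix e :: real assume "e > 0"
  \<comment> \<open>\<open>M + 1\<close> instead of \<open>M\<close> keeps the divisor positive for
    \<open>M = 0\<close> and leaves room for the strict inequality at the end.\<close>
  define e' where "e' = e / (2 * (M + 1))"
  have "e' > 0" using \<open>e > 0\<close> \<open>M \<ge> 0\<close> by (simp add: e'_def)
  obtain d1 where d1: "d1 > 0" "\<And>D :: (real \<times> real) set. finite D \<and> (\<forall>(r, s)\<in>D. c \<le> r \<and> r \<le> s \<and> s \<le> d) \<and>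
        disjoint_family_on (\<lambda>(r, s). {r<..<s}) D \<and> (\<Sum>(r, s)\<in>D. s - r) < d1 \<Longrightarrow>
        (\<Sum>(r, s)\<in>D. \<bar>g s - g r\<bar>) < e'"
    using assms(1) \<open>e' > 0\<close> unfolding abs_continuous_on_interval_def by meson
  obtain d2 where d2: "d2 > 0" "\<And>D :: (real \<times> real) set. finite D \<and> (\<forall>(r, s)\<in>D. c \<le> r \<and> r \<le> s \<and> s \<le> d) \<and>
        disjoint_family_on (\<lambda>(r, s). {r<..<s}) D \<and> (\<Sum>(r, s)\<in>D. s - r) < d2 \<Longrightarrow>
        (\<Sum>(r, s)\<in>D. \<bar>h s - h r\<bar>) < e'"
    using assms(2) \<open>e' > 0\<close> unfolding abs_continuous_on_interval_def by meson
  show "\<exists>\<delta>>0. \<forall>D :: (real \<times> real) set. finite D \<and> (\<forall>(r, s)\<in>D. c \<le> r \<and> r \<le> s \<and> s \<le> d) \<and>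
        disjoint_family_on (\<lambda>(r, s). {r<..<s}) D \<and> (\<Sum>(r, s)\<in>D. s - r) < \<delta> \<longrightarrow>
        (\<Sum>(r, s)\<in>D. \<bar>k s - k r\<bar>) < e"
  proof (intro exI[of _ "min d1 d2"] conjI allI impI)
    fix D :: "(real \<times> real) set"
    assume D: "finite D \<and> (\<forall>(r, s)\<in>D. c \<le> r \<and> r \<le> s \<and> s \<le> d) \<and>
        disjoint_family_on (\<lambda>(r, s). {r<..<s}) D \<and> (\<Sum>(r, s)\<in>D. s - r) < min d1 d2"
    have "(\<Sum>(r, s)\<in>D. \<bar>k s - k r\<bar>) \<le> (\<Sum>(r, s)\<in>D. M * (\<bar>g s - g r\<bar> + \<bar>h s - h r\<bar>))"
      using D by (intro sum_mono) (auto intro!: bound)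
    also have "\<dots> = M * ((\<Sum>(r, s)\<in>D. \<bar>g s - g r\<bar>) + (\<Sum>(r, s)\<in>D. \<bar>h s - h r\<bar>))"
      by (simp add: case_prod_unfold sum_distrib_left[symmetric] sum.distrib[symmetric])
    also have "\<dots> \<le> M * (2 * e')"
      using d1(2)[of D] d2(2)[of D] D \<open>M \<ge> 0\<close> by (intro mult_left_mono) auto
    also have "\<dots> < (M + 1) * (2 * e')"
      using \<open>e' > 0\<close> by (intro mult_strict_right_mono) auto
    also have "\<dots> = e"
      using \<open>M \<ge> 0\<close> by (simp add: e'_def field_simps)
    finally show "(\<Sum>(r, s)\<in>D. \<bar>k s - k r\<bar>) < e" .
  qed (use d1(1) d2(1) in auto)
qed

lemma abs_continuous_on_interval_ident: "abs_continuous_on_interval c d (\<lambda>t. t)"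
  unfolding abs_continuous_on_interval_def
proof (intro allI impI)
  fix e :: real assume "e > 0"
  show "\<exists>\<delta>>0. \<forall>D :: (real \<times> real) set. finite D \<and> (\<forall>(r, s)\<in>D. c \<le> r \<and> r \<le> s \<and> s \<le> d) \<and>
        disjoint_family_on (\<lambda>(r, s). {r<..<s}) D \<and> (\<Sum>(r, s)\<in>D. s - r) < \<delta> \<longrightarrow>
        (\<Sum>(r, s)\<in>D. \<bar>s - r\<bar>) < e"
  proof (intro exI[of _ e] conjI allI impI)
    fix D :: "(real \<times> real) set"
    assume D: "finite D \<and> (\<forall>(r, s)\<in>D. c \<le> r \<and> r \<le> s \<and> s \<le> d) \<and>
        disjoint_family_on (\<lambda>(r, s). {r<..<s}) D \<and> (\<Sum>(r, s)\<in>D. s - r) < e"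
    have "(\<Sum>(r, s)\<in>D. \<bar>s - r\<bar>) = (\<Sum>(r, s)\<in>D. s - r)"
      using D by (intro sum.cong) auto
    with D show "(\<Sum>(r, s)\<in>D. \<bar>s - r\<bar>) < e" by simp
  qed (use \<open>e > 0\<close> in auto)
qed

text \<open>A bounded derivative makes \<open>g\<close> Lipschitz, so its increments are dominated
  by those of the identity, which fills both slots of the comparison.\<close>

lemma abs_continuous_on_interval_C1:
  assumes "\<And>t. t \<in> {c..d} \<Longrightarrow> (g has_real_derivative g' t) (at t within {c..d})"
    and "continuous_on {c..d} g'"
  shows "abs_continuous_on_interval c d g"
proof -
  have "bounded (g' ` {c..d})"
    by (intro compact_imp_bounded compact_continuous_image assms(2)) auto
  then obtain M where M: "M > 0" "\<And>t. t \<in> {c..d} \<Longrightarrow> norm (g' t) \<le> M"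
    by (auto simp: bounded_pos)
  show ?thesis
  proof (rule abs_continuous_on_interval_dominated[OF abs_continuous_on_interval_ident abs_continuous_on_interval_ident])
    fix r s assume "c \<le> r" "r \<le> s" "s \<le> d"
    then have "norm (g s - g r) \<le> M * norm (s - r)"
      by (intro field_differentiable_bound[of "{c..d}" g g'] assms M) auto
    also have "\<dots> \<le> M * (\<bar>s - r\<bar> + \<bar>s - r\<bar>)"
      using M by (intro mult_left_mono) auto
    finally show "\<bar>g s - g r\<bar> \<le> M * (\<bar>s - r\<bar> + \<bar>s - r\<bar>)" by simp
  qed (use M in auto)
qed

lemma abs_continuous_on_interval_add:
  assumes "abs_continuous_on_interval c d g" "abs_continuous_on_interval c d h"
  shows "abs_continuous_on_interval c d (\<lambda>t. g t + h t)"
  by (rule abs_continuous_on_interval_dominated[OF assms, of 1]) auto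

lemma abs_continuous_on_interval_diff:
  assumes "abs_continuous_on_interval c d g" "abs_continuous_on_interval c d h"
  shows "abs_continuous_on_interval c d (\<lambda>t. g t - h t)"
  by (rule abs_continuous_on_interval_dominated[OF assms, of 1]) auto

lemma abs_continuous_on_interval_mult:
  assumes "abs_continuous_on_interval c d g" "abs_continuous_on_interval c d h"
    and "continuous_on {c..d} g" "continuous_on {c..d} h"
  shows "abs_continuous_on_interval c d (\<lambda>t. g t * h t)"
proof -
  have "bounded (g ` {c..d})" "bounded (h ` {c..d})"
    by (intro compact_imp_bounded compact_continuous_image assms(3,4) compact_Icc)+
  then obtain M1 M2 where M: "M1 > 0" "M2 > 0"
    "\<And>t. t \<in> {c..d} \<Longrightarrow> \<bar>g t\<bar> \<le> M1" "\<And>t. t \<in> {c..d} \<Longrightarrow> \<bar>h t\<bar> \<le> M2"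
    by (auto simp: bounded_pos)
  show ?thesis
  proof (rule abs_continuous_on_interval_dominated[OF assms(1,2), of "M1 + M2"])
    fix r s assume rs: "c \<le> r" "r \<le> s" "s \<le> d"
    have "g s * h s - g r * h r = g s * (h s - h r) + h r * (g s - g r)"
      by (simp add: algebra_simps)
    then have "\<bar>g s * h s - g r * h r\<bar> \<le> \<bar>g s\<bar> * \<bar>h s - h r\<bar> + \<bar>h r\<bar> * \<bar>g s - g r\<bar>"
      by (metis abs_mult abs_triangle_ineq)
    also have "\<dots> \<le> (M1 + M2) * \<bar>h s - h r\<bar> + (M1 + M2) * \<bar>g s - g r\<bar>"
      using M(1,2) M(3)[of s] M(4)[of r] rs by (intro add_mono mult_right_mono) auto
    finally show "\<bar>g s * h s - g r * h r\<bar> \<le> (M1 + M2) * (\<bar>g s - g r\<bar> + \<bar>h s - h r\<bar>)"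
      by (simp add: algebra_simps)
  qed (use M in auto)
qed

text \<open>Turns the total length in the definition of absolute continuity into the measure of a
  set, to be compared with an open set or used under an integral.\<close>

lemma sum_length_disjoint_intervals:
  fixes D :: "(real \<times> real) set"
  assumes "finite D" "disjoint_family_on (\<lambda>(r, s). {r<..<s}) D" "\<And>r s. (r, s) \<in> D \<Longrightarrow> r \<le> s"
  shows "(\<Sum>(r, s)\<in>D. s - r) = measure lebesgue (\<Union>(r, s)\<in>D. {r<..<s})"
proof -
  have "measure lebesgue (\<Union>p\<in>D. case p of (r, s) \<Rightarrow> {r<..<s}) = (\<Sum>p\<in>D. measure lebesgue (case p of (r, s) \<Rightarrow> {r<..<s}))"
    by (rule measure_finite_Union[OF assms(1) _ assms(2)]) (use assms(3) in auto)
  also have "\<dots> = (\<Sum>(r, s)\<in>D. s - r)"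
    using assms(3) by (intro sum.cong) auto
  finally show ?thesis by simp
qed

text \<open>A gauge argument: Cousin's lemma gives a tagged division whose intervals tagged outside \<open>N\<close>
  contribute little by the derivative, and those tagged in \<open>N\<close> by absolute continuity.\<close>

lemma abs_continuous_zero_derivative:
  assumes ac: "abs_continuous_on_interval 0 T g" and "T \<ge> 0" and N: "negligible N"
    and der: "\<And>t. t \<in> {0..T} - N \<Longrightarrow> (g has_real_derivative 0) (at t within {0..T})"
  shows "g T = g 0"
proof -
  \<comment> \<open>Tags in \<open>N\<close> will contribute at most \<open>e\<close>, all other
    tags at most \<open>e * T\<close>.\<close>
  have "\<bar>g T - g 0\<bar> \<le> e * (1 + T)" if "e > 0" for e
  proof -
    obtain d where d: "d > 0" "\<And>D :: (real \<times> real) set. finite D \<Longrightarrow> (\<forall>(r, s)\<in>D. 0 \<le> r \<and> r \<le> s \<and> s \<le> T) \<Longrightarrow>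
        disjoint_family_on (\<lambda>(r, s). {r<..<s}) D \<Longrightarrow> (\<Sum>(r, s)\<in>D. s - r) < d \<Longrightarrow>
        (\<Sum>(r, s)\<in>D. \<bar>g s - g r\<bar>) < e"
      using ac \<open>e > 0\<close> unfolding abs_continuous_on_interval_def by meson
    have "N \<in> sets lebesgue"
      by (rule negligible_imp_sets[OF N])
    then obtain U where U: "open U" "N \<subseteq> U" "U - N \<in> lmeasurable" "emeasure lebesgue (U - N) < ennreal d"
      using sets_lebesgue_outer_open[OF _ \<open>d > 0\<close>] by blast
    have Um: "U \<in> lmeasurable"
      using U(2,3) negligible_imp_measurable[OF N] fmeasurable.Un[of "U - N" lebesgue N] by (simp add: Un_absorb2)
    have "measure lebesgue U = measure lebesgue (U - N)"
      using N U(1) by (simp add: measure_Diff_null_set negligible_iff_null_sets)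
    also have "\<dots> < d"
      using U(3,4) \<open>d > 0\<close> by (simp add: emeasure_eq_measure2 ennreal_less_iff)
    finally have Ud: "measure lebesgue U < d" .
    have "\<exists>r>0. \<forall>s\<in>{0..T}. \<bar>s - t\<bar> < r \<longrightarrow> \<bar>g s - g t\<bar> \<le> e * \<bar>s - t\<bar>" if "t \<in> {0..T} - N" for t
      using der[OF that] \<open>e > 0\<close> unfolding has_field_derivative_def has_derivative_within_alt by auto
    then obtain \<rho> where \<rho>: "\<And>t. t \<in> {0..T} - N \<Longrightarrow> \<rho> t > 0"
      "\<And>t s. t \<in> {0..T} - N \<Longrightarrow> s \<in> {0..T} \<Longrightarrow> \<bar>s - t\<bar> < \<rho> t \<Longrightarrow> \<bar>g s - g t\<bar> \<le> e * \<bar>s - t\<bar>"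
      by metis
    \<comment> \<open>Intervals tagged in \<open>N\<close> must lie in \<open>U\<close>, whose
      measure is below \<open>d\<close>; elsewhere the radius makes difference quotients at the tag
      at most \<open>e\<close>. The radius 1 is a filler outside \<open>{0..T}\<close>, where no
      tags occur.\<close>
    define \<gamma> where "\<gamma> t = (if t \<in> N then U else ball t (if t \<in> {0..T} then \<rho> t else 1))" for t
    have "gauge \<gamma>"
      unfolding gauge_def \<gamma>_def using U(1,2) \<rho>(1) by auto
    then obtain p where p: "p tagged_division_of {0..T}" "\<gamma> fine p"
      using fine_division_exists_real by blast
    note pD = tagged_division_ofD[OF p(1)]
    have pK: "\<exists>u v. K = {u..v} \<and> u \<le> x \<and> x \<le> v \<and> Inf K = u \<and> Sup K = v \<and> 0 \<le> u \<and> v \<le> T \<and> K \<subseteq> \<gamma> x"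
      if xK: "(x, K) \<in> p" for x K
    proof -
      obtain u v where uv: "K = {u..v}" using pD(4)[OF xK] by auto
      moreover have "x \<in> K" "K \<subseteq> {0..T}" using pD(2,3)[OF xK] by auto
      moreover have "K \<subseteq> \<gamma> x" using p(2) xK by (auto simp: fine_def)
      ultimately show ?thesis by (intro exI[of _ u] exI[of _ v]) auto
    qed
    have p_le: "0 \<le> Inf K \<and> Inf K \<le> Sup K \<and> Sup K \<le> T" if "(x, K) \<in> p" for x K
      using pK[OF that] by (elim exE conjE) linarith
    \<comment> \<open>Degenerate intervals are discarded: they contribute nothing, and without them
      distinct members of \<open>q\<close> have disjoint nonempty interiors, so that
      \<open>\<phi>\<close> is injective.\<close>
    define q where "q = {(x, K) \<in> p. x \<in> N \<and> interior K \<noteq> {}}"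
    have "finite p" "finite q" "q \<subseteq> p"
      using pD(1) by (auto simp: q_def intro: finite_subset)
    define \<phi> where "\<phi> = (\<lambda>(x :: real, K :: real set). (Inf K, Sup K))"
    have disj: "interior K \<inter> interior L = {}" if "(x, K) \<in> q" "(y, L) \<in> q" "(x, K) \<noteq> (y, L)" for x y K L
      using pD(5) that \<open>q \<subseteq> p\<close> by blast
    have intK: "interior K = {Inf K<..<Sup K}" if xK: "(x, K) \<in> q" for x K
    proof -
      obtain u v where K: "K = {u..v}" "Inf K = u" "Sup K = v"
        using pK[of x K] xK \<open>q \<subseteq> p\<close> by blast
      show ?thesis
        unfolding K(2,3) unfolding K(1) by (rule interior_atLeastAtMost_real)
    qed
    have inj: "inj_on \<phi> q"
    proof (rule inj_onI, clarify)
      fix x K y L assume *: "(x, K) \<in> q" "(y, L) \<in> q" "\<phi> (x, K) = \<phi> (y, L)"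
      then have "interior K = interior L"
        using intK by (auto simp: \<phi>_def)
      with disj[OF *(1,2)] * show "x = y \<and> K = L"
        by (auto simp: q_def)
    qed
    have "(\<Sum>(r, s)\<in>\<phi> ` q. \<bar>g s - g r\<bar>) < e"
    proof (rule d(2))
      show "finite (\<phi> ` q)" using \<open>finite q\<close> by simp
      show le: "\<forall>(r, s)\<in>\<phi> ` q. 0 \<le> r \<and> r \<le> s \<and> s \<le> T"
        using p_le \<open>q \<subseteq> p\<close> by (auto simp: \<phi>_def)
      show dj: "disjoint_family_on (\<lambda>(r, s). {r<..<s}) (\<phi> ` q)"
        unfolding disjoint_family_on_def
      proof (intro ballI impI)
        fix m n assume "m \<in> \<phi> ` q" "n \<in> \<phi> ` q" "m \<noteq> n"
        then obtain x K y L where *: "(x, K) \<in> q" "(y, L) \<in> q" "m = \<phi> (x, K)" "n = \<phi> (y, L)" "(x, K) \<noteq> (y, L)"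
          by auto
        then show "(case m of (r, s) \<Rightarrow> {r<..<s}) \<inter> (case n of (r, s) \<Rightarrow> {r<..<s}) = {}"
          using disj[OF *(1,2,5)] intK[OF *(1)] intK[OF *(2)] by (simp add: \<phi>_def)
      qed
      have "(\<Sum>(r, s)\<in>\<phi> ` q. s - r) = measure lebesgue (\<Union>(r, s)\<in>\<phi> ` q. {r<..<s})"
        using \<open>finite q\<close> dj le by (intro sum_length_disjoint_intervals) auto
      also have "\<dots> \<le> measure lebesgue U"
      proof (rule measure_mono_fmeasurable[OF _ _ Um])
        show "(\<Union>(r, s)\<in>\<phi> ` q. {r<..<s}) \<subseteq> U"
        proof
          fix z assume "z \<in> (\<Union>(r, s)\<in>\<phi> ` q. {r<..<s})"
          then obtain x K where xK: "(x, K) \<in> q" "z \<in> interior K"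
            using intK by (auto simp: \<phi>_def)
          moreover have "interior K \<subseteq> K" by (rule interior_subset)
          moreover have "K \<subseteq> \<gamma> x"
            using p(2) xK(1) \<open>q \<subseteq> p\<close> unfolding fine_def by blast
          moreover have "\<gamma> x = U"
            using xK(1) by (simp add: q_def \<gamma>_def)
          ultimately show "z \<in> U" by blast
        qed
      qed (auto intro!: sets.finite_UN \<open>finite q\<close> simp: \<phi>_def)
      finally show "(\<Sum>(r, s)\<in>\<phi> ` q. s - r) < d" using Ud by simp
    qed
    moreover have "(\<Sum>(r, s)\<in>\<phi> ` q. \<bar>g s - g r\<bar>) = (\<Sum>(x, K)\<in>q. \<bar>g (Sup K) - g (Inf K)\<bar>)"
      unfolding sum.reindex[OF inj] by (simp add: \<phi>_def case_prod_unfold o_def)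
    ultimately have qsum: "(\<Sum>(x, K)\<in>q. \<bar>g (Sup K) - g (Inf K)\<bar>) < e"
      by simp
    have "g T - g 0 = (\<Sum>(x, K)\<in>p. g (Sup K) - g (Inf K))"
      using additive_tagged_division_1[OF \<open>T \<ge> 0\<close> p(1), of g] by simp
    then have "\<bar>g T - g 0\<bar> \<le> (\<Sum>(x, K)\<in>p. \<bar>g (Sup K) - g (Inf K)\<bar>)"
      by (simp add: case_prod_unfold sum_abs)
    also have "\<dots> = (\<Sum>(x, K)\<in>q. \<bar>g (Sup K) - g (Inf K)\<bar>) + (\<Sum>(x, K)\<in>p - q. \<bar>g (Sup K) - g (Inf K)\<bar>)"
      using sum.subset_diff[OF \<open>q \<subseteq> p\<close> \<open>finite p\<close>] by (simp add: add.commute)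
    also have "(\<Sum>(x, K)\<in>p - q. \<bar>g (Sup K) - g (Inf K)\<bar>) \<le> (\<Sum>(x, K)\<in>p - q. e * (Sup K - Inf K))"
    proof (rule sum_mono, clarify)
      fix x K assume xK: "(x, K) \<in> p" "(x, K) \<notin> q"
      then obtain u v where K: "K = {u..v}" "u \<le> x" "x \<le> v" "Inf K = u" "Sup K = v" "0 \<le> u" "v \<le> T" "K \<subseteq> \<gamma> x"
        using pK by blast
      show "\<bar>g (Sup K) - g (Inf K)\<bar> \<le> e * (Sup K - Inf K)"
      proof (cases "x \<in> N")
        case True
        then have "interior K = {}" using xK by (auto simp: q_def)
        then have "u = v" using K by (auto simp: K(1))
        then show ?thesis unfolding K(4,5) by simp
      next
        case False
        then have x: "x \<in> {0..T} - N" using K by auto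
        \<comment> \<open>The tag lies between the end points, so the bounds for its two sides add
          up to one for the whole interval.\<close>
        then have "{u..v} \<subseteq> ball x (\<rho> x)"
          using K by (auto simp: \<gamma>_def)
        then have "\<bar>u - x\<bar> < \<rho> x" "\<bar>v - x\<bar> < \<rho> x"
          using K(2,3) order_trans[OF K(2,3)] unfolding subset_iff
          by (metis abs_minus_commute atLeastAtMost_iff dist_real_def mem_ball order_refl)+
        moreover have "u \<in> {0..T}" "v \<in> {0..T}"
          using K by auto
        ultimately have "\<bar>g u - g x\<bar> \<le> e * \<bar>u - x\<bar>" "\<bar>g v - g x\<bar> \<le> e * \<bar>v - x\<bar>"
          using \<rho>(2)[OF x] by blast+
        then have "\<bar>g v - g u\<bar> \<le> e * (x - u) + e * (v - x)"
          using K by simp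
        then show ?thesis unfolding K(4,5) by (simp add: algebra_simps)
      qed
    qed
    also have "\<dots> \<le> (\<Sum>(x, K)\<in>p. e * (Sup K - Inf K))"
    proof (rule sum_mono2[OF \<open>finite p\<close>])
      fix m assume "m \<in> p - (p - q)"
      then show "0 \<le> (case m of (x, K) \<Rightarrow> e * (Sup K - Inf K))"
        using p_le \<open>e > 0\<close> by (cases m) (auto intro!: mult_nonneg_nonneg)
    qed auto
    also have "\<dots> = e * (\<Sum>(x, K)\<in>p. Sup K - Inf K)"
      by (simp add: sum_distrib_left case_prod_unfold)
    also have "(\<Sum>(x, K)\<in>p. Sup K - Inf K) = T"
      using additive_tagged_division_1[OF \<open>T \<ge> 0\<close> p(1), of "\<lambda>x. x"] by simp
    finally show ?thesis
      using qsum by (simp add: algebra_simps)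
  qed
  note * = this
  show ?thesis
  proof (rule ccontr)
    assume "g T \<noteq> g 0"
    then have "0 < \<bar>g T - g 0\<bar>" by simp
    then have "\<bar>g T - g 0\<bar> \<le> \<bar>g T - g 0\<bar> / (2 * (1 + T)) * (1 + T)"
      using \<open>T \<ge> 0\<close> by (intro *) simp
    also have "\<dots> = \<bar>g T - g 0\<bar> / 2"
      using \<open>T \<ge> 0\<close> by (simp add: field_simps)
    finally show False
      using \<open>0 < \<bar>g T - g 0\<bar>\<close> by simp
  qed
qed

section \<open>Indefinite integrals of locally integrable functions\<close>

lemma L1_loc_set_integrable:
  assumes "L1_loc f" "A \<in> sets lebesgue" "A \<subseteq> {0..T}"
  shows "set_integrable lebesgue A f"
proof -
  \<comment> \<open>\<open>L1_loc\<close> speaks only of nonnegative end points; for negative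
    \<open>T\<close> the set \<open>A\<close> is empty.\<close>
  have "set_integrable lebesgue {0..max 0 T} f"
    using assms(1) by (auto simp: L1_loc_def)
  then show ?thesis
    by (rule set_integrable_subset) (use assms(2,3) in auto)
qed

lemma L1_loc_integrable_on:
  assumes "L1_loc f" "0 \<le> r"
  shows "f integrable_on {r..s}"
  using L1_loc_set_integrable[OF assms(1), of "{r..s}" s] assms(2)
  by (auto intro: set_lebesgue_integral_eq_integral)

text \<open>At negative arguments the interval is empty and the value is 0, so for locally
  integrable \<open>f\<close> this is continuous on the whole line and can be integrated and shifted
  without case distinctions.\<close>

definition primitive :: "(real \<Rightarrow> real) \<Rightarrow> real \<Rightarrow> real" where
  "primitive f t = integral {0..t} f"

lemma primitive_0 [simp]: "primitive f 0 = 0"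
  by (simp add: primitive_def)

lemma primitive_diff:
  assumes "L1_loc f" "0 \<le> r" "r \<le> s"
  shows "primitive f s - primitive f r = integral {r..s} f"
  using Henstock_Kurzweil_Integration.integral_combine[OF assms(2,3) L1_loc_integrable_on[OF assms(1), of 0 s]]
  by (simp add: primitive_def)

lemma continuous_on_primitive:
  assumes "L1_loc f"
  shows "continuous_on UNIV (primitive f)"
proof -
  have "isCont (primitive f) t" for t
  proof -
    define T where "T = \<bar>t\<bar> + 1"
    have "continuous_on {0..T} (\<lambda>t. integral {0..t} f)"
      using assms by (intro indefinite_integral_continuous_1 L1_loc_integrable_on) auto
    then have "continuous_on {- T..T} (\<lambda>t. integral {0..max 0 t} f)"
      by (rule continuous_on_compose2) (auto intro!: continuous_intros simp: T_def)
    moreover have "integral {0..max 0 t} f = primitive f t" for t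
      by (cases "t \<ge> 0") (auto simp: primitive_def max_def)
    ultimately have "continuous_on {- T..T} (primitive f)"
      by simp
    moreover have "t \<in> interior {- T..T}"
      by (auto simp: T_def)
    ultimately show ?thesis
      by (rule continuous_on_interior)
  qed
  then show ?thesis
    by (simp add: continuous_on_eq_continuous_at)
qed

text \<open>The integrands are dominated by \<open>k\<close> and eventually zero at each point, so
  dominated convergence applies.\<close>

lemma integral_tail_small:
  fixes k :: "real \<Rightarrow> real"
  assumes "integrable M k" "e > 0" "\<And>x. k x \<ge> 0"
  obtains n :: nat where "(LINT x|M. indicator {x. k x > real n} x * k x) < e"
proof -
  have [measurable]: "k \<in> borel_measurable M"
    using assms(1) by auto
  have "(\<lambda>n. LINT x|M. indicator {x. k x > real n} x * k x) \<longlonglongrightarrow> (LINT x|M. 0)"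
  proof (rule integral_dominated_convergence[where w = k])
    show "AE x in M. (\<lambda>n. indicator {x. k x > real n} x * k x) \<longlonglongrightarrow> 0"
    proof (rule AE_I2)
      fix x
      obtain m where "k x \<le> real m" using real_arch_simple by blast
      then have "\<forall>\<^sub>F n in sequentially. indicator {x. k x > real n} x * k x = 0"
        unfolding eventually_sequentially by (intro exI[of _ m]) (auto simp: indicator_def)
      then show "(\<lambda>n. indicator {x. k x > real n} x * k x) \<longlonglongrightarrow> 0"
        by (rule tendsto_eventually)
    qed
    show "(\<lambda>x. indicator {x. k x > real n} x * k x) \<in> borel_measurable M" for n
    proof -
      have "(\<lambda>x. indicator {x. k x > real n} x * k x) = (\<lambda>x. if k x > real n then k x else 0)"
        by (auto simp: indicator_def)
      then show ?thesis by simp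
    qed
    show "AE x in M. norm (indicator {x. k x > real n} x * k x) \<le> k x" for n
      using assms(3) by (auto simp: indicator_def)
  qed (use assms in auto)
  then have "(\<lambda>n. LINT x|M. indicator {x. k x > real n} x * k x) \<longlonglongrightarrow> 0"
    by simp
  then have "\<forall>\<^sub>F n in sequentially. (LINT x|M. indicator {x. k x > real n} x * k x) < e"
    using \<open>e > 0\<close> by (rule order_tendstoD)
  then show ?thesis
    using that by (auto simp: eventually_sequentially)
qed

text \<open>\<open>\<bar>f\<bar>\<close> is split at a height \<open>n\<close>: the part above has
  integral below \<open>e / 2\<close>, and the rest is at most \<open>n\<close>, hence contributes
  little over a set of small measure.\<close>

lemma abs_continuous_primitive:
  assumes f: "L1_loc f"
  shows "abs_continuous_on_interval 0 T (primitive f)"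
  unfolding abs_continuous_on_interval_def
proof (intro allI impI)
  fix e :: real assume "e > 0"
  define k where "k x = indicator {0..T} x * \<bar>f x\<bar>" for x
  have "set_integrable lebesgue {0..T} f"
    using f by (rule L1_loc_set_integrable) auto
  then have k: "integrable lebesgue k"
    unfolding k_def[abs_def] using set_integrable_abs[of lebesgue "{0..T}" f]
    by (simp add: set_integrable_def)
  have k0: "k x \<ge> 0" for x by (simp add: k_def)
  obtain n where n: "(LINT x|lebesgue. indicator {x. k x > real n} x * k x) < e / 2"
    using integral_tail_small[OF k, of "e / 2"] k0 \<open>e > 0\<close> by auto
  define h where "h x = indicator {x. k x > real n} x * k x" for x
  have h0: "h x \<ge> 0" for x using k0 by (simp add: h_def)
  have kh: "k x \<le> h x + real n" for x
    using k0[of x] by (auto simp: h_def indicator_def)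
  have h: "integrable lebesgue h"
  proof (rule Bochner_Integration.integrable_bound[OF k])
    have [measurable]: "k \<in> borel_measurable lebesgue" using k by auto
    have "h = (\<lambda>x. if k x > real n then k x else 0)"
      by (auto simp: h_def indicator_def)
    then show "h \<in> borel_measurable lebesgue" by simp
    show "AE x in lebesgue. norm (h x) \<le> norm (k x)"
      using k0 by (auto simp: h_def indicator_def)
  qed
  show "\<exists>\<delta>>0. \<forall>D :: (real \<times> real) set. finite D \<and> (\<forall>(r, s)\<in>D. 0 \<le> r \<and> r \<le> s \<and> s \<le> T) \<and>
        disjoint_family_on (\<lambda>(r, s). {r<..<s}) D \<and> (\<Sum>(r, s)\<in>D. s - r) < \<delta> \<longrightarrow>
        (\<Sum>(r, s)\<in>D. \<bar>primitive f s - primitive f r\<bar>) < e"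
  \<comment> \<open>With this length the part bounded by \<open>n\<close> contributes at most
    \<open>e / 2\<close>; \<open>n + 1\<close> covers the case \<open>n = 0\<close>.\<close>
  proof (intro exI[of _ "e / (2 * (real n + 1))"] conjI allI impI)
    fix D :: "(real \<times> real) set"
    assume "finite D \<and> (\<forall>(r, s)\<in>D. 0 \<le> r \<and> r \<le> s \<and> s \<le> T) \<and>
        disjoint_family_on (\<lambda>(r, s). {r<..<s}) D \<and> (\<Sum>(r, s)\<in>D. s - r) < e / (2 * (real n + 1))"
    then have D: "finite D" "\<And>r s. (r, s) \<in> D \<Longrightarrow> 0 \<le> r \<and> r \<le> s \<and> s \<le> T"
      "disjoint_family_on (\<lambda>(r, s). {r<..<s}) D" "(\<Sum>(r, s)\<in>D. s - r) < e / (2 * (real n + 1))"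
      by auto
    define I where "I = (\<lambda>(r, s). {r<..<s :: real})"
    define V where "V = \<Union>(I ` D)"
    have IT: "I m \<subseteq> {0..T}" if "m \<in> D" for m
      using D(2) that by (cases m) (fastforce simp: I_def)
    have Is: "I m \<in> sets lebesgue" for m
      by (cases m) (simp add: I_def)
    have V: "V \<in> lmeasurable"
    proof (rule fmeasurableI2[of "{0..T}"])
      show "V \<subseteq> {0..T}"
        using IT by (auto simp: V_def)
      show "V \<in> sets lebesgue"
        unfolding V_def using D(1) Is by (intro sets.finite_UN) auto
    qed simp
    have ik: "integrable lebesgue (\<lambda>x. indicator (I m) x * k x)" for m
      using integrable_mult_indicator[OF Is k] by simp
    have step: "\<bar>primitive f s - primitive f r\<bar> \<le> (LINT x|lebesgue. indicator (I (r, s)) x * k x)"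
      if rs: "(r, s) \<in> D" for r s
    proof -
      have fi: "set_integrable lebesgue {r<..<s} f"
        using D(2)[OF rs] by (intro L1_loc_set_integrable[OF f, of _ T]) auto
      have "primitive f s - primitive f r = integral {r<..<s} f"
        using primitive_diff[OF f, of r s] D(2)[OF rs] by (simp add: integral_open_interval_real)
      also have "\<dots> = (LINT x:{r<..<s}|lebesgue. f x)"
        using set_lebesgue_integral_eq_integral(2)[OF fi] by simp
      also have "\<bar>\<dots>\<bar> \<le> (LINT x|lebesgue. norm (indicator {r<..<s} x *\<^sub>R f x))"
        unfolding set_lebesgue_integral_def using integral_norm_bound[of lebesgue "\<lambda>x. indicator {r<..<s} x *\<^sub>R f x"] by simp
      also have "\<dots> = (LINT x|lebesgue. indicator (I (r, s)) x * k x)"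
        using D(2)[OF rs] by (intro Bochner_Integration.integral_cong) (auto simp: I_def k_def indicator_def)
      finally show ?thesis by simp
    qed
    have "(\<Sum>(r, s)\<in>D. \<bar>primitive f s - primitive f r\<bar>) \<le> (\<Sum>m\<in>D. LINT x|lebesgue. indicator (I m) x * k x)"
      using step by (intro sum_mono) auto
    also have "\<dots> = (LINT x|lebesgue. (\<Sum>m\<in>D. indicator (I m) x * k x))"
      by (rule Bochner_Integration.integral_sum[symmetric]) (rule ik)
    also have "\<dots> = (LINT x|lebesgue. indicator V x * k x)"
    proof (rule Bochner_Integration.integral_cong)
      fix x
      have "(indicator V x :: real) = (\<Sum>m\<in>D. indicator (I m) x)"
        unfolding V_def using D(1,3) by (intro indicator_UN_disjoint) (auto simp: I_def)
      then show "(\<Sum>m\<in>D. indicator (I m) x * k x) = indicator V x * k x"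
        by (simp add: sum_distrib_right)
    qed simp
    also have "\<dots> \<le> (LINT x|lebesgue. h x + real n * indicator V x)"
    proof (rule integral_mono)
      show "integrable lebesgue (\<lambda>x. indicator V x * k x)"
        using integrable_mult_indicator[OF _ k, of V] V by (simp add: fmeasurableD)
      show "integrable lebesgue (\<lambda>x. h x + real n * indicator V x)"
        using h V by (auto intro!: Bochner_Integration.integrable_add simp: fmeasurable_def)
      show "indicator V x * k x \<le> h x + real n * indicator V x" for x
        using kh[of x] h0[of x] by (auto simp: indicator_def)
    qed
    also have "\<dots> = (LINT x|lebesgue. h x) + real n * measure lebesgue V"
      using h V by (subst Bochner_Integration.integral_add) (auto simp: fmeasurable_def)
    also have "measure lebesgue V = (\<Sum>(r, s)\<in>D. s - r)"
      unfolding V_def I_def using D by (intro sum_length_disjoint_intervals[symmetric]) auto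
    also have "(LINT x|lebesgue. h x) + real n * (\<Sum>(r, s)\<in>D. s - r) < e / 2 + e / 2"
    proof (rule add_less_le_mono)
      show "(LINT x|lebesgue. h x) < e / 2" using n by (simp add: h_def[abs_def])
      have "real n * (\<Sum>(r, s)\<in>D. s - r) \<le> real n * (e / (2 * (real n + 1)))"
        using D(4) by (intro mult_left_mono) auto
      also have "\<dots> \<le> (real n + 1) * (e / (2 * (real n + 1)))"
        using \<open>e > 0\<close> by (intro mult_right_mono) auto
      also have "\<dots> = e / 2" by (simp add: field_simps)
      finally show "real n * (\<Sum>(r, s)\<in>D. s - r) \<le> e / 2" .
    qed
    finally show "(\<Sum>(r, s)\<in>D. \<bar>primitive f s - primitive f r\<bar>) < e" by simp
  qed (use \<open>e > 0\<close> in auto)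
qed

text \<open>The Lebesgue differentiation theorem for cubes with a corner at \<open>x\<close>, read
  in dimension one, where they are intervals to the right of \<open>x\<close>.\<close>

lemma integral_difference_quotient_AE:
  fixes g :: "real \<Rightarrow> real"
  assumes "\<And>a b. g integrable_on {a..b}"
  obtains N where "negligible N"
    and "\<And>x e. x \<notin> N \<Longrightarrow> 0 < e \<Longrightarrow>
      \<exists>d>0. \<forall>h. 0 < h \<and> h < d \<longrightarrow> \<bar>integral {x..x + h} g / h - g x\<bar> < e"
proof -
  have "\<And>a b. g integrable_on cbox a b"
    using assms by simp
  from integrable_ccontinuous_explicit[OF this] obtain N where N: "negligible N"
    "\<And>x e. x \<notin> N \<Longrightarrow> 0 < e \<Longrightarrow> \<exists>d>0. \<forall>h. 0 < h \<and> h < d \<longrightarrow>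
       norm (integral (cbox x (x + h *\<^sub>R One)) g /\<^sub>R h ^ DIM(real) - g x) < e"
    by blast
  show ?thesis
    by (rule that[OF N(1)]) (use N(2) in \<open>simp add: divide_inverse mult.commute\<close>)
qed

text \<open>The library has the Lebesgue differentiation theorem for right difference quotients; the left
  ones are obtained by reflection.\<close>

lemma primitive_has_derivative_AE:
  assumes f: "L1_loc f"
  obtains N where "negligible N"
    and "\<And>t. t \<ge> 0 \<Longrightarrow> t \<notin> N \<Longrightarrow> (primitive f has_real_derivative f t) (at t within {0..})"
proof -
  \<comment> \<open>Extension by zero gives integrability over every interval, including those that
    reach to the left of 0.\<close>
  define g where "g x = (if x \<in> {0..} then f x else 0)" for x
  have g: "g integrable_on {r..s}" for r s
  proof -
    have "{0..} \<inter> {r..s} = {max 0 r..s}" by auto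
    then have "f integrable_on ({0..} \<inter> {r..s})"
      using L1_loc_integrable_on[OF f, of "max 0 r" s] by simp
    then show ?thesis
      unfolding g_def[abs_def] integrable_restrict_Int .
  qed
  have gI: "integral {r..s} g = primitive f s - primitive f r" if "0 \<le> r" "r \<le> s" for r s
  proof -
    have "integral {r..s} g = integral {r..s} f"
      using that by (intro integral_cong) (auto simp: g_def)
    then show ?thesis using primitive_diff[OF f that] by simp
  qed
  obtain N1 where N1: "negligible N1" "\<And>x e. x \<notin> N1 \<Longrightarrow> 0 < e \<Longrightarrow>
      \<exists>d>0. \<forall>h. 0 < h \<and> h < d \<longrightarrow> \<bar>integral {x..x + h} g / h - g x\<bar> < e"
    using integral_difference_quotient_AE[OF g] by blast
  have g': "(\<lambda>x. g (- x)) integrable_on {r..s}" for r s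
    using g[of "- s" "- r"] Henstock_Kurzweil_Integration.integrable_reflect_real[of g "- r" "- s"] by simp
  obtain N2 where N2: "negligible N2" "\<And>x e. x \<notin> N2 \<Longrightarrow> 0 < e \<Longrightarrow>
      \<exists>d>0. \<forall>h. 0 < h \<and> h < d \<longrightarrow> \<bar>integral {x..x + h} (\<lambda>x. g (- x)) / h - g (- x)\<bar> < e"
    using integral_difference_quotient_AE[OF g'] by blast
  show ?thesis
  proof (rule that)
    show "negligible (N1 \<union> uminus ` N2)"
    proof (intro negligible_Un N1(1))
      \<comment> \<open>Reflection is Lipschitz, so the exceptional set stays negligible when
        carried back.\<close>
      show "negligible (uminus ` N2)"
      proof (rule negligible_locally_Lipschitz_image[OF _ N2(1)])
        fix x :: real
        show "\<exists>T B. open T \<and> x \<in> T \<and> (\<forall>y\<in>N2 \<inter> T. norm (- y - - x) \<le> B * norm (y - x))"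
          by (intro exI[of _ "UNIV :: real set"] exI[of _ "1 :: real"]) (simp add: abs_minus_commute)
      qed simp
    qed
    fix t :: real assume t: "t \<ge> 0" "t \<notin> N1 \<union> uminus ` N2"
    then have "- t \<notin> N2" by force
    show "(primitive f has_real_derivative f t) (at t within {0..})"
      unfolding has_field_derivative_iff
    proof (rule tendstoI)
      fix e :: real assume "e > 0"
      obtain d1 where d1: "d1 > 0" "\<And>h. 0 < h \<Longrightarrow> h < d1 \<Longrightarrow> \<bar>integral {t..t + h} g / h - g t\<bar> < e"
        using N1(2)[of t e] t \<open>e > 0\<close> by blast
      obtain d2 where d2: "d2 > 0" "\<And>h. 0 < h \<Longrightarrow> h < d2 \<Longrightarrow> \<bar>integral {(- t)..(- t) + h} (\<lambda>x. g (- x)) / h - g (- (- t))\<bar> < e"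
        using N2(2)[of "- t" e] \<open>- t \<notin> N2\<close> \<open>e > 0\<close> by blast
      have "dist ((primitive f s - primitive f t) / (s - t)) (f t) < e"
        if s: "s \<ge> 0" "s \<noteq> t" "dist s t < min d1 d2" for s
      proof (cases "s > t")
        case True
        then show ?thesis
          using d1(2)[of "s - t"] s t(1) gI[of t s] by (simp add: dist_real_def g_def)
      next
        case False
        \<comment> \<open>The left quotient at \<open>t\<close> is the right quotient of the
          reflected function at \<open>- t\<close>.\<close>
        have "integral {- t..- s} (\<lambda>x. g (- x)) = primitive f t - primitive f s"
          using gI[of s t] False s t(1) by simp
        then have "\<bar>(primitive f t - primitive f s) / (t - s) - f t\<bar> < e"
          using d2(2)[of "t - s"] False s t(1) by (simp add: dist_real_def g_def)
        moreover have "(primitive f t - primitive f s) / (t - s) = (primitive f s - primitive f t) / (s - t)"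
          by (metis minus_diff_eq minus_divide_divide)
        ultimately show ?thesis by (simp add: dist_real_def)
      qed
      then show "\<forall>\<^sub>F s in at t within {0..}. dist ((primitive f s - primitive f t) / (s - t)) (f t) < e"
        unfolding eventually_at using d1(1) d2(1) by (intro exI[of _ "min d1 d2"]) auto
    qed
  qed
qed

lemma L1_loc_continuous_mult:
  assumes "L1_loc f" "continuous_on UNIV \<phi>"
  shows "L1_loc (\<lambda>s. \<phi> s * f s)"
  unfolding L1_loc_def
proof (intro allI impI)
  fix T :: real assume "T \<ge> 0"
  have c: "continuous_on {0..T} \<phi>"
    using assms(2) by (rule continuous_on_subset) auto
  show "set_integrable lebesgue {0..T} (\<lambda>s. \<phi> s * f s)"
  proof (rule absolutely_integrable_bounded_measurable_product_real)
    show "\<phi> \<in> borel_measurable (lebesgue_on {0..T})"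
      using c by (intro continuous_imp_measurable_on_sets_lebesgue) auto
    show "bounded (\<phi> ` {0..T})"
      using c by (intro compact_imp_bounded compact_continuous_image) auto
    show "set_integrable lebesgue {0..T} f"
      using assms(1) \<open>T \<ge> 0\<close> by (auto simp: L1_loc_def)
  qed auto
qed

text \<open>Both sides are absolutely continuous in \<open>t\<close> with the same derivative almost
  everywhere, so their difference is constant; \<open>primitive f 0 = 0\<close> removes the lower
  boundary term.\<close>

lemma primitive_by_parts:
  assumes f: "L1_loc f"
    and \<phi>: "\<And>t. (\<phi> has_real_derivative \<phi>' t) (at t)" "continuous_on UNIV \<phi>'"
    and K: "\<And>t. (K has_real_derivative \<phi>' t * primitive f t) (at t)"
    and "t \<ge> 0"
  shows "primitive (\<lambda>s. \<phi> s * f s) t = \<phi> t * primitive f t - (K t - K 0)"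
proof -
  have c\<phi>: "continuous_on UNIV \<phi>"
    using \<phi>(1) by (meson DERIV_isCont continuous_at_imp_continuous_on)
  have f\<phi>: "L1_loc (\<lambda>s. \<phi> s * f s)"
    by (rule L1_loc_continuous_mult[OF f c\<phi>])
  define W where "W t = primitive (\<lambda>s. \<phi> s * f s) t - (\<phi> t * primitive f t - K t)" for t
  obtain N1 where N1: "negligible N1"
    "\<And>t. t \<ge> 0 \<Longrightarrow> t \<notin> N1 \<Longrightarrow> (primitive f has_real_derivative f t) (at t within {0..})"
    using primitive_has_derivative_AE[OF f] by blast
  obtain N2 where N2: "negligible N2"
    "\<And>t. t \<ge> 0 \<Longrightarrow> t \<notin> N2 \<Longrightarrow> (primitive (\<lambda>s. \<phi> s * f s) has_real_derivative \<phi> t * f t) (at t within {0..})"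
    using primitive_has_derivative_AE[OF f\<phi>] by blast
  have "W t = W 0"
  proof (rule abs_continuous_zero_derivative[OF _ \<open>t \<ge> 0\<close>])
    have sub: "continuous_on {0..t} g" if "continuous_on UNIV g" for g :: "real \<Rightarrow> real"
      using that by (rule continuous_on_subset) auto
    have cP: "continuous_on UNIV (primitive f)"
      by (rule continuous_on_primitive[OF f])
    show "abs_continuous_on_interval 0 t W"
      unfolding W_def[abs_def]
    proof (intro abs_continuous_on_interval_diff abs_continuous_on_interval_mult
        abs_continuous_primitive f f\<phi> sub c\<phi> cP)
      show "abs_continuous_on_interval 0 t \<phi>"
        by (rule abs_continuous_on_interval_C1[OF has_field_derivative_at_within[OF \<phi>(1)] sub[OF \<phi>(2)]])
      show "abs_continuous_on_interval 0 t K"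
        by (rule abs_continuous_on_interval_C1[OF has_field_derivative_at_within[OF K]])
          (intro sub continuous_intros \<phi>(2) cP)
    qed
    show "negligible (N1 \<union> N2)"
      using N1(1) N2(1) by (rule negligible_Un)
    fix s assume s: "s \<in> {0..t} - (N1 \<union> N2)"
    have P: "(primitive f has_real_derivative f s) (at s within {0..t})"
      "(primitive (\<lambda>s. \<phi> s * f s) has_real_derivative \<phi> s * f s) (at s within {0..t})"
      using s by (auto intro!: DERIV_subset[OF N1(2)] DERIV_subset[OF N2(2)])
    have "(W has_real_derivative \<phi> s * f s - ((\<phi>' s * primitive f s + f s * \<phi> s) - \<phi>' s * primitive f s)) (at s within {0..t})"
      unfolding W_def[abs_def]
      by (intro DERIV_diff DERIV_mult P has_field_derivative_at_within[OF \<phi>(1)] has_field_derivative_at_within[OF K])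
    then show "(W has_real_derivative 0) (at s within {0..t})"
      by (simp add: mult.commute)
  qed
  then show ?thesis
    by (simp add: W_def)
qed

lemma antiderivative_exists:
  fixes g :: "real \<Rightarrow> 'a::euclidean_space"
  assumes "continuous_on UNIV g"
  obtains K where "\<And>t. (K has_vector_derivative g t) (at t)"
proof -
  have "isCont g x" for x
    using assms by (simp add: continuous_on_eq_continuous_at)
  then have "\<exists>K. \<forall>x::real. -\<infinity> < ereal x \<longrightarrow> ereal x < \<infinity> \<longrightarrow> (K has_vector_derivative g x) (at x)"
    by (intro einterval_antiderivative) auto
  then show ?thesis
    using that by auto
qed

lemma antiderivative_real_exists:
  fixes g :: "real \<Rightarrow> real"
  assumes "continuous_on UNIV g"
  obtains K where "\<And>t. (K has_real_derivative g t) (at t)"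
  using antiderivative_exists[OF assms] unfolding has_real_derivative_iff_has_vector_derivative
  by blast

section \<open>Linear systems\<close>

lemma exp_factor_vector_derivative:
  fixes y :: "real \<Rightarrow> complex"
  assumes "(y has_vector_derivative (\<mu> * y t + g t)) (at t within S)"
  shows "((\<lambda>t. exp (- \<mu> * of_real t) * y t) has_vector_derivative exp (- \<mu> * of_real t) * g t)
           (at t within S)"
proof -
  have "((\<lambda>t. exp (- \<mu> * of_real t)) has_vector_derivative - \<mu> * exp (- \<mu> * of_real t)) (at t within S)"
    by (rule has_vector_derivative_real_field) (auto intro!: derivative_eq_intros)
  from has_vector_derivative_mult[OF this assms]
  show ?thesis
    by (simp add: algebra_simps)
qed

lemma first_order_zero:
  fixes y :: "real \<Rightarrow> complex"
  assumes y: "\<And>t. t \<ge> 0 \<Longrightarrow> (y has_vector_derivative (\<mu> * y t)) (at t within {0..})"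
    and "y 0 = 0" "t \<ge> 0"
  shows "y t = 0"
proof -
  define W where "W t = exp (- \<mu> * of_real t) * y t" for t :: real
  have "(W has_vector_derivative 0) (at t within {0..})" if "t \<in> {0..}" for t
    using exp_factor_vector_derivative[of y \<mu> t "\<lambda>_. 0"] y[of t] that by (simp add: W_def[abs_def])
  then obtain c where "\<And>t. t \<in> {0..} \<Longrightarrow> W t = c"
    using has_vector_derivative_zero_constant[of "{0..}" W] by (metis convex_real_interval(1))
  then have "W t = W 0"
    using assms by auto
  then show ?thesis
    using assms by (simp add: W_def)
qed

lemma first_order_exists:
  fixes g :: "real \<Rightarrow> complex"
  assumes "continuous_on {0..} g"
  obtains y where "y 0 = y0"
    and "\<And>t. t \<ge> 0 \<Longrightarrow> (y has_vector_derivative (\<mu> * y t + g t)) (at t within {0..})"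
proof -
  \<comment> \<open>Freezing the integrand to the left of 0 gives a continuous function on the whole
    line, which has an antiderivative there.\<close>
  define h where "h t = exp (- \<mu> * of_real (max 0 t)) * g (max 0 t)" for t
  have "continuous_on UNIV (\<lambda>t. g (max 0 t))"
    by (rule continuous_on_compose2[OF assms]) (auto intro!: continuous_intros)
  then have "continuous_on UNIV h"
    unfolding h_def[abs_def] by (intro continuous_intros)
  then obtain K where K: "\<And>t. (K has_vector_derivative h t) (at t)"
    using antiderivative_exists by blast
  define y where "y t = exp (\<mu> * of_real t) * (y0 + (K t - K 0))" for t :: real
  show ?thesis
  proof
    show "y 0 = y0"
      by (simp add: y_def)
    fix t :: real assume "t \<ge> 0"
    have 1: "((\<lambda>t. exp (\<mu> * of_real t)) has_vector_derivative \<mu> * exp (\<mu> * of_real t)) (at t within {0..})"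
      by (rule has_vector_derivative_real_field) (auto intro!: derivative_eq_intros)
    have 2: "((\<lambda>t. y0 + (K t - K 0)) has_vector_derivative h t) (at t within {0..})"
      using K[of t] by (auto intro!: derivative_eq_intros intro: has_vector_derivative_at_within)
    have "exp (\<mu> * of_real t) * h t = g t"
      using \<open>t \<ge> 0\<close> by (simp add: h_def exp_minus)
    with has_vector_derivative_mult[OF 1 2]
    show "(y has_vector_derivative (\<mu> * y t + g t)) (at t within {0..})"
      unfolding y_def by (simp add: algebra_simps)
  qed
qed

text \<open>Once \<open>norm (g t) \<le> d\<close>, the function \<open>W\<close> grows no faster
  than \<open>d / c * exp (c * t)\<close>; undoing the integrating factor leaves a decaying term
  plus \<open>d / c\<close>.\<close>

lemma first_order_tendsto_zero:
  fixes y :: "real \<Rightarrow> complex"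
  assumes y: "\<And>t. t \<ge> 0 \<Longrightarrow> (y has_vector_derivative (\<mu> * y t + g t)) (at t within {0..})"
    and g: "(g \<longlongrightarrow> 0) at_top" and "Re \<mu> < 0"
  shows "(y \<longlongrightarrow> 0) at_top"
proof (rule tendstoI)
  fix e :: real assume "e > 0"
  define c where "c = - Re \<mu>"
  have "c > 0" using assms by (simp add: c_def)
  define W where "W t = exp (- \<mu> * of_real t) * y t" for t :: real
  \<comment> \<open>This makes the remaining error \<open>d / c\<close> equal to
    \<open>e / 2\<close>.\<close>
  define d where "d = e * c / 2"
  have "d > 0" using \<open>e > 0\<close> \<open>c > 0\<close> by (simp add: d_def)
  then have "eventually (\<lambda>t. norm (g t) < d) at_top"
    using g by (auto simp: tendsto_iff)
  then obtain T where T: "T \<ge> 0" "\<And>t. t \<ge> T \<Longrightarrow> norm (g t) \<le> d"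
    unfolding eventually_at_top_linorder by (metis linorder_le_cases order_trans less_imp_le)
  have W': "(W has_vector_derivative exp (- \<mu> * of_real t) * g t) (at t within {0..})" if "t \<ge> 0" for t
    unfolding W_def[abs_def] using y[OF that] by (rule exp_factor_vector_derivative)
  have nexp: "norm (exp (- \<mu> * of_real t)) = exp (c * t)" for t :: real
    by (simp add: c_def)
  have bound: "norm (y t) \<le> exp (- c * t) * norm (W T) + d / c" if "t > T" for t
  proof -
    have "norm (W t - W T) \<le> d / c * exp (c * t) - d / c * exp (c * T)"
    proof (rule differentiable_bound_general[OF that])
      show "continuous_on {T..t} W"
      proof (rule continuous_on_vector_derivative)
        fix s assume "s \<in> {T..t}"
        then show "(W has_vector_derivative exp (- \<mu> * of_real s) * g s) (at s within {T..t})"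
          using T(1) by (intro has_vector_derivative_within_subset[OF W']) auto
      qed
      show "continuous_on {T..t} (\<lambda>t. d / c * exp (c * t))"
        by (intro continuous_intros)
      fix s assume s: "T < s" "s < t"
      show "(W has_vector_derivative exp (- \<mu> * of_real s) * g s) (at s)"
      proof -
        have "at s within {0..} = at s"
          by (rule at_within_interior) (use s T(1) in simp)
        with W'[of s] s T(1) show ?thesis
          by simp
      qed
      show "((\<lambda>t. d / c * exp (c * t)) has_vector_derivative d * exp (c * s)) (at s)"
        unfolding has_real_derivative_iff_has_vector_derivative[symmetric]
        using \<open>c > 0\<close> by (auto intro!: derivative_eq_intros)
      show "norm (exp (- \<mu> * of_real s) * g s) \<le> d * exp (c * s)"
        using T(2)[of s] s unfolding norm_mult nexp by (simp add: mult.commute)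
    qed
    also have "\<dots> \<le> d / c * exp (c * t)"
      using \<open>d > 0\<close> \<open>c > 0\<close> by simp
    finally have "norm (W t) \<le> norm (W T) + d / c * exp (c * t)"
      using norm_triangle_sub[of "W t" "W T"] by linarith
    moreover have "norm (W t) = exp (c * t) * norm (y t)"
      unfolding W_def norm_mult nexp by simp
    ultimately have "exp (- c * t) * (exp (c * t) * norm (y t)) \<le> exp (- c * t) * (norm (W T) + d / c * exp (c * t))"
      by (intro mult_left_mono) auto
    also have "\<dots> = exp (- c * t) * norm (W T) + d / c * (exp (- c * t) * exp (c * t))"
      by (simp only: distrib_left mult_ac)
    finally have "(exp (- c * t) * exp (c * t)) * norm (y t)
        \<le> exp (- c * t) * norm (W T) + d / c * (exp (- c * t) * exp (c * t))"
      by (simp only: mult.assoc)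
    moreover have "exp (- c * t) * exp (c * t) = 1"
      by (simp add: exp_minus)
    ultimately show ?thesis
      by simp
  qed
  have "((\<lambda>t. exp (- c * t) * norm (W T)) \<longlongrightarrow> 0) at_top"
  proof (rule tendsto_mult_left_zero)
    have "filterlim (\<lambda>t. - (c * t)) at_bot at_top"
      using \<open>c > 0\<close> by (simp add: filterlim_uminus_at_bot filterlim_tendsto_pos_mult_at_top[OF tendsto_const] filterlim_ident)
    then show "((\<lambda>t. exp (- c * t)) \<longlongrightarrow> 0) at_top"
      using filterlim_compose[OF exp_at_bot] by auto
  qed
  then have "eventually (\<lambda>t. exp (- c * t) * norm (W T) < e / 2) at_top"
    using \<open>e > 0\<close> by (intro order_tendstoD) auto
  with eventually_gt_at_top[of T] show "eventually (\<lambda>t. dist (y t) 0 < e) at_top"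
  proof eventually_elim
    case (elim t)
    have "d / c = e / 2" using \<open>c > 0\<close> by (simp add: d_def)
    then show ?case using bound[OF elim(1)] elim(2) by simp
  qed
qed

section \<open>Planar systems and their characteristic roots\<close>

lemma characteristic_roots:
  fixes a b :: real
  assumes "a > 0" "b > 0"
  obtains \<nu> \<mu> :: complex where "\<nu> + \<mu> = - of_real a" "\<nu> * \<mu> = of_real b" "Re \<nu> < 0" "Re \<mu> < 0"
proof (cases "a\<^sup>2 \<ge> 4 * b")
  case True
  define s where "s = sqrt (a\<^sup>2 - 4 * b)"
  have s: "s\<^sup>2 = a\<^sup>2 - 4 * b" "s \<ge> 0"
    using True by (auto simp: s_def)
  \<comment> \<open>As \<open>b > 0\<close>, the root of the discriminant stays below
    \<open>a\<close>, so both real roots are negative.\<close>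
  then have "s\<^sup>2 < a\<^sup>2" using assms by linarith
  then have "s < a" by (rule power2_less_imp_less) (use assms in simp)
  have "(- a + s) / 2 * ((- a - s) / 2) = (a\<^sup>2 - s\<^sup>2) / 4"
    by (simp add: power2_eq_square algebra_simps)
  also have "\<dots> = b"
    unfolding s(1) by simp
  finally have prod: "(- a + s) / 2 * ((- a - s) / 2) = b" .
  show ?thesis
  proof (rule that[of "complex_of_real ((- a + s) / 2)" "complex_of_real ((- a - s) / 2)"])
    show "complex_of_real ((- a + s) / 2) + complex_of_real ((- a - s) / 2) = - complex_of_real a"
      unfolding of_real_add[symmetric] by (simp add: diff_divide_distrib add_divide_distrib)
    show "complex_of_real ((- a + s) / 2) * complex_of_real ((- a - s) / 2) = complex_of_real b"
      unfolding of_real_mult[symmetric] prod ..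
    show "Re (complex_of_real ((- a + s) / 2)) < 0" "Re (complex_of_real ((- a - s) / 2)) < 0"
      unfolding Re_complex_of_real using assms s(2) \<open>s < a\<close> by simp_all
  qed
next
  case False
  define s where "s = sqrt (4 * b - a\<^sup>2)"
  have s: "s\<^sup>2 = 4 * b - a\<^sup>2"
    using False by (auto simp: s_def)
  have "a * a / 4 + s * s / 4 = (a\<^sup>2 + s\<^sup>2) / 4"
    by (simp add: power2_eq_square add_divide_distrib)
  also have "\<dots> = b"
    unfolding s by simp
  finally have r: "a * a / 4 + s * s / 4 = b" .
  show ?thesis
  proof (rule that[of "Complex (- a / 2) (s / 2)" "Complex (- a / 2) (- s / 2)"])
    show "Complex (- a / 2) (s / 2) * Complex (- a / 2) (- s / 2) = complex_of_real b"
      using r by (simp add: complex_eq_iff)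
  qed (use assms in \<open>simp_all add: complex_eq_iff\<close>)
qed

text \<open>Formally \<open>u'' + a * u' + b * u = g' + h\<close>; carrying \<open>p\<close> along
  avoids differentiating \<open>g\<close>. The original equation has \<open>h = 0\<close>; a nonzero
  \<open>h\<close> arises when a small function is subtracted from its solution.\<close>

definition linear_system ::
  "real \<Rightarrow> real \<Rightarrow> (real \<Rightarrow> real) \<Rightarrow> (real \<Rightarrow> real) \<Rightarrow> (real \<Rightarrow> real) \<Rightarrow> (real \<Rightarrow> real) \<Rightarrow> bool" where
  "linear_system a b g h u p \<longleftrightarrow>
     (\<forall>t\<ge>0. (u has_real_derivative p t - a * u t + g t) (at t within {0..}) \<and>
            (p has_real_derivative - b * u t + h t) (at t within {0..}))"

text \<open>If \<open>\<nu>, \<mu>\<close> are the characteristic roots, then \<open>q = \<mu> u + p\<close> decouples the system into two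
  scalar equations with coefficients \<open>\<mu>\<close> and \<open>\<lambda>\<close>, without a case distinction on \<open>\<nu> = \<mu>\<close>.\<close>

lemma linear_system_triangular:
  fixes \<nu> \<mu> :: complex
  assumes sys: "linear_system a b g h u p" and roots: "\<nu> + \<mu> = - of_real a" "\<nu> * \<mu> = of_real b"
    and "t \<ge> 0"
  defines "q \<equiv> \<lambda>t. \<mu> * of_real (u t) + of_real (p t)"
  shows "(q has_vector_derivative (\<mu> * q t + (\<mu> * of_real (g t) + of_real (h t)))) (at t within {0..})"
    and "((\<lambda>t. complex_of_real (u t)) has_vector_derivative (\<nu> * of_real (u t) + (q t + of_real (g t))))
           (at t within {0..})"
proof -
  have u: "((\<lambda>t. complex_of_real (u t)) has_vector_derivative of_real (p t - a * u t + g t)) (at t within {0..})"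
    and p: "((\<lambda>t. complex_of_real (p t)) has_vector_derivative of_real (- b * u t + h t)) (at t within {0..})"
    using sys \<open>t \<ge> 0\<close> unfolding linear_system_def by (intro has_vector_derivative_of_real; blast)+
  have ab: "complex_of_real a = - (\<nu> + \<mu>)" "complex_of_real b = \<nu> * \<mu>"
    using roots by auto
  show "((\<lambda>t. complex_of_real (u t)) has_vector_derivative (\<nu> * of_real (u t) + (q t + of_real (g t))))
           (at t within {0..})"
    by (rule has_vector_derivative_eq_rhs[OF u]) (simp add: q_def ab algebra_simps)
  have "(q has_vector_derivative \<mu> * of_real (p t - a * u t + g t) + of_real (- b * u t + h t)) (at t within {0..})"
    unfolding q_def
    by (intro has_vector_derivative_add has_vector_derivative_mult_right u p)
  then show "(q has_vector_derivative (\<mu> * q t + (\<mu> * of_real (g t) + of_real (h t)))) (at t within {0..})"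
    by (rule has_vector_derivative_eq_rhs) (simp add: q_def ab algebra_simps)
qed

text \<open>The triangular form is a cascade of stable scalar equations: first
  \<open>\<mu> * u + p\<close> tends to zero, then \<open>u\<close>, for which that function is part
  of the input.\<close>

lemma linear_system_tendsto_zero:
  assumes "linear_system a b g h u p" "a > 0" "b > 0"
    and "(g \<longlongrightarrow> 0) at_top" "(h \<longlongrightarrow> 0) at_top"
  shows "(u \<longlongrightarrow> 0) at_top"
proof -
  obtain \<nu> \<mu> :: complex
    where r: "\<nu> + \<mu> = - of_real a" "\<nu> * \<mu> = of_real b" "Re \<nu> < 0" "Re \<mu> < 0"
    using characteristic_roots[OF assms(2,3)] by blast
  note tri = linear_system_triangular[OF assms(1) r(1,2)]
  have g0: "((\<lambda>t. complex_of_real (g t)) \<longlongrightarrow> 0) at_top" and h0: "((\<lambda>t. complex_of_real (h t)) \<longlongrightarrow> 0) at_top"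
    using tendsto_of_real[OF assms(4), where 'a=complex] tendsto_of_real[OF assms(5), where 'a=complex] by auto
  have "((\<lambda>t. \<mu> * of_real (u t) + of_real (p t)) \<longlongrightarrow> 0) at_top"
    using tri(1) by (rule first_order_tendsto_zero[OF _ _ r(4)])
      (auto intro!: tendsto_add_zero tendsto_mult_right_zero g0 h0)
  from tendsto_add_zero[OF this g0] have "((\<lambda>t. complex_of_real (u t)) \<longlongrightarrow> 0) at_top"
    by (intro first_order_tendsto_zero[OF _ _ r(3), of "\<lambda>t. complex_of_real (u t)"
          "\<lambda>t. \<mu> * of_real (u t) + of_real (p t) + of_real (g t)"] tri(2))
  from tendsto_Re[OF this] show ?thesis
    by simp
qed

text \<open>The difference of the solutions satisfies the homogeneous system with zero initial
  values, and both stages of the cascade vanish.\<close>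

lemma linear_system_unique:
  assumes "linear_system a b g h u p" "linear_system a b g h u' p'" "a > 0" "b > 0"
    and "u 0 = u' 0" "p 0 = p' 0" and "t \<ge> 0"
  shows "u t = u' t"
proof -
  define v w where "v t = u t - u' t" and "w t = p t - p' t" for t
  have sys: "linear_system a b (\<lambda>_. 0) (\<lambda>_. 0) v w"
    unfolding linear_system_def
  proof (intro allI impI conjI)
    fix t :: real assume "t \<ge> 0"
    with assms(1,2) have
      u: "(u has_real_derivative p t - a * u t + g t) (at t within {0..})"
         "(u' has_real_derivative p' t - a * u' t + g t) (at t within {0..})" and
      p: "(p has_real_derivative - b * u t + h t) (at t within {0..})"
         "(p' has_real_derivative - b * u' t + h t) (at t within {0..})"
      unfolding linear_system_def by simp_all
    show "(v has_real_derivative w t - a * v t + 0) (at t within {0..})"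
      unfolding v_def[abs_def] w_def
      by (rule DERIV_cong[OF DERIV_diff[OF u]]) (simp add: algebra_simps)
    show "(w has_real_derivative - b * v t + 0) (at t within {0..})"
      unfolding w_def[abs_def] v_def
      by (rule DERIV_cong[OF DERIV_diff[OF p]]) (simp add: algebra_simps)
  qed
  obtain \<nu> \<mu> :: complex
    where r: "\<nu> + \<mu> = - of_real a" "\<nu> * \<mu> = of_real b"
    using characteristic_roots[OF assms(3,4)] by blast
  note tri = linear_system_triangular[OF sys r]
  have 0: "v 0 = 0" "w 0 = 0"
    using assms by (auto simp: v_def w_def)
  have q: "\<mu> * of_real (v t) + of_real (w t) = 0" if "t \<ge> 0" for t
    by (rule first_order_zero[of "\<lambda>t. \<mu> * of_real (v t) + of_real (w t)" \<mu>, OF _ _ that])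
      (use tri(1) in \<open>simp_all add: 0\<close>)
  have "complex_of_real (v t) = 0"
    by (rule first_order_zero[of "\<lambda>t. complex_of_real (v t)" \<nu>, OF _ _ \<open>t \<ge> 0\<close>])
      (use tri(2) q in \<open>simp_all add: 0\<close>)
  then show ?thesis
    by (simp add: v_def)
qed

text \<open>The cascade is solved from the top over the complex numbers, \<open>q\<close> first and
  then \<open>y\<close>.\<close>

lemma linear_system_exists:
  assumes "continuous_on {0..} g" "continuous_on {0..} h" "a > 0" "b > 0"
  obtains u p where "linear_system a b g h u p" "u 0 = u0" "p 0 = p0"
proof -
  obtain \<nu> \<mu> :: complex
    where r: "\<nu> + \<mu> = - of_real a" "\<nu> * \<mu> = of_real b"
    using characteristic_roots[OF assms(3,4)] by blast
  have ab: "complex_of_real a = - (\<nu> + \<mu>)" "complex_of_real b = \<nu> * \<mu>"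
    using r by auto
  have "continuous_on {0..} (\<lambda>t. \<mu> * of_real (g t) + complex_of_real (h t))"
    using assms(1,2) by (intro continuous_intros)
  then obtain q where q0: "q 0 = \<mu> * of_real u0 + of_real p0"
    and q: "\<And>t. t \<ge> 0 \<Longrightarrow> (q has_vector_derivative (\<mu> * q t + (\<mu> * of_real (g t) + complex_of_real (h t)))) (at t within {0..})"
    by (rule first_order_exists[where \<mu> = \<mu> and ?y0.0 = "\<mu> * of_real u0 + of_real p0"]) blast
  have "continuous_on {0..} q"
    using q by (intro continuous_on_vector_derivative) auto
  then have "continuous_on {0..} (\<lambda>t. q t + complex_of_real (g t))"
    using assms(1) by (intro continuous_intros)
  then obtain y where y0: "y 0 = complex_of_real u0"
    and y: "\<And>t. t \<ge> 0 \<Longrightarrow> (y has_vector_derivative (\<nu> * y t + (q t + complex_of_real (g t)))) (at t within {0..})"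
    by (rule first_order_exists[where \<mu> = \<nu> and ?y0.0 = "complex_of_real u0"]) blast
  have Re': "((\<lambda>t. Re (f t)) has_real_derivative Re f') (at t within {0..})"
    if "(f has_vector_derivative f') (at t within {0..})" for f f' t
    unfolding has_real_derivative_iff_has_vector_derivative
    by (rule bounded_linear.has_vector_derivative[OF bounded_linear_Re that])
  show ?thesis
  proof
    \<comment> \<open>The relation \<open>q = \<mu> * y + p\<close> is solved for \<open>p\<close>.
      Since \<open>a\<close>, \<open>b\<close> and the inputs are real, the real parts of a complex
      solution form a solution.\<close>
    show "linear_system a b g h (\<lambda>t. Re (y t)) (\<lambda>t. Re (q t - \<mu> * y t))"
      unfolding linear_system_def
    proof (intro allI impI conjI)
      fix t :: real assume t: "t \<ge> 0"
      have "Re (q t - \<mu> * y t) - a * Re (y t) + g t = Re (q t - \<mu> * y t - of_real a * y t + of_real (g t))"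
        by simp
      also have "\<dots> = Re (\<nu> * y t + (q t + of_real (g t)))"
        by (simp only: ab) (simp add: algebra_simps)
      finally show "((\<lambda>t. Re (y t)) has_real_derivative Re (q t - \<mu> * y t) - a * Re (y t) + g t) (at t within {0..})"
        using Re'[OF y[OF t]] by (simp only:)
      have "((\<lambda>t. q t - \<mu> * y t) has_vector_derivative
              \<mu> * q t + (\<mu> * of_real (g t) + of_real (h t)) - \<mu> * (\<nu> * y t + (q t + of_real (g t)))) (at t within {0..})"
        by (intro has_vector_derivative_diff has_vector_derivative_mult_right q y t)
      moreover have "\<mu> * q t + (\<mu> * of_real (g t) + of_real (h t)) - \<mu> * (\<nu> * y t + (q t + of_real (g t)))
          = - of_real b * y t + of_real (h t)"
        by (simp only: ab) (simp add: algebra_simps)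
      ultimately have "((\<lambda>t. q t - \<mu> * y t) has_vector_derivative - of_real b * y t + of_real (h t)) (at t within {0..})"
        by (simp only:)
      from Re'[OF this] show "((\<lambda>t. Re (q t - \<mu> * y t)) has_real_derivative - b * Re (y t) + h t) (at t within {0..})"
        by simp
    qed
  qed (auto simp: y0 q0)
qed

section \<open>Backward differences\<close>

definition bdiff :: "real \<Rightarrow> (real \<Rightarrow> real) \<Rightarrow> real \<Rightarrow> real" where
  "bdiff p K t = K t - K (t - p)"

text \<open>The hub of the equivalence: for a second primitive \<open>H\<close> of \<open>f\<close>
  this is the uniform condition on \<open>F\<close>.\<close>

definition second_differences_vanish :: "(real \<Rightarrow> real) \<Rightarrow> bool" where
  "second_differences_vanish H \<longleftrightarrow>
     (\<forall>e>0. \<forall>\<^sub>F t in at_top. \<forall>p\<in>{0..1}. \<forall>q\<in>{0..1}. \<bar>bdiff p (bdiff q H) t\<bar> \<le> e)"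

lemma bdiff_commute: "bdiff p (bdiff q H) t = bdiff q (bdiff p H) t"
  by (simp add: bdiff_def algebra_simps)

lemma DERIV_bdiff:
  assumes "\<And>t. (K has_real_derivative k t) (at t)"
  shows "(bdiff p K has_real_derivative bdiff p k t) (at t)"
  unfolding bdiff_def[abs_def]
  by (intro DERIV_diff assms DERIV_chain'[where g = K, of "\<lambda>t. t - p" 1, simplified])
    (auto intro!: derivative_eq_intros)

lemma DERIV_shifted:
  assumes "\<And>t. (K has_real_derivative k t) (at t)"
  shows "((\<lambda>\<theta>. K (t - \<theta>)) has_real_derivative - k (t - \<theta>)) (at \<theta>)"
proof -
  have "((\<lambda>\<theta>. t - \<theta>) has_real_derivative - 1) (at \<theta>)"
    by (auto intro!: derivative_eq_intros)
  from DERIV_chain2[OF assms this] show ?thesis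
    by simp
qed

text \<open>\<open>bdiff 1 K1 t\<close> is the average of \<open>K\<close> over
  \<open>{t - 1..t}\<close>, so the estimated quantity is the average of \<open>bdiff p K t\<close>
  over \<open>p\<close> in \<open>{0..1}\<close>.\<close>

lemma bdiff_antiderivative_bound:
  assumes "\<And>t. (K1 has_real_derivative K t) (at t)"
    and "\<And>p. 0 \<le> p \<Longrightarrow> p \<le> 1 \<Longrightarrow> \<bar>bdiff p K t\<bar> \<le> e"
  shows "\<bar>K t - bdiff 1 K1 t\<bar> \<le> e"
proof -
  \<comment> \<open>The derivative in \<open>\<theta>\<close> is \<open>bdiff \<theta> K t\<close>,
    and \<open>g 1 - g 0\<close> is the quantity to be estimated.\<close>
  define g where "g \<theta> = \<theta> * K t - (K1 t - K1 (t - \<theta>))" for \<theta>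
  have "norm (g 1 - g 0) \<le> e * norm (1 - 0 :: real)"
  proof (rule field_differentiable_bound[of "{0..1}"])
    fix \<theta> :: real assume \<theta>: "\<theta> \<in> {0..1}"
    have "(g has_real_derivative 1 * K t - (0 - - K (t - \<theta>))) (at \<theta>)"
      unfolding g_def[abs_def]
      by (intro DERIV_diff DERIV_shifted assms(1) DERIV_const DERIV_cmult_right DERIV_ident)
    then show "(g has_real_derivative bdiff \<theta> K t) (at \<theta> within {0..1})"
      by (simp add: bdiff_def has_field_derivative_at_within)
    show "norm (bdiff \<theta> K t) \<le> e"
      using assms(2) \<theta> by simp
  qed auto
  then show ?thesis
    by (simp add: g_def bdiff_def)
qed

text \<open>The bound is averaged over one increment, then over both. With \<open>M\<close> the
  average over \<open>{t - 1..t}\<close>, \<open>bdiff 1 H1\<close> is \<open>M H\<close> and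
  \<open>bdiff 1 (bdiff 1 H2)\<close> is \<open>M (M H)\<close>.\<close>

lemma second_difference_averages:
  assumes H1: "\<And>t. (H1 has_real_derivative H t) (at t)"
    and H2: "\<And>t. (H2 has_real_derivative H1 t) (at t)"
    and bound: "\<And>p q. 0 \<le> p \<Longrightarrow> p \<le> 1 \<Longrightarrow> 0 \<le> q \<Longrightarrow> q \<le> 1 \<Longrightarrow> \<bar>bdiff p (bdiff q H) t\<bar> \<le> e"
  shows "\<bar>bdiff 1 H t - bdiff 1 (bdiff 1 H1) t\<bar> \<le> e"
    and "\<bar>H t - 2 * bdiff 1 H1 t + bdiff 1 (bdiff 1 H2) t\<bar> \<le> e"
proof -
  have 1: "\<bar>bdiff q H t - bdiff 1 (bdiff q H1) t\<bar> \<le> e" if "0 \<le> q" "q \<le> 1" for q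
    using that by (intro bdiff_antiderivative_bound DERIV_bdiff H1 bound)
  from this[of 1] show "\<bar>bdiff 1 H t - bdiff 1 (bdiff 1 H1) t\<bar> \<le> e"
    by simp
  define K where "K s = H s - bdiff 1 H1 s" for s
  define K1 where "K1 s = H1 s - bdiff 1 H2 s" for s
  have "\<bar>K t - bdiff 1 K1 t\<bar> \<le> e"
  proof (rule bdiff_antiderivative_bound)
    show "(K1 has_real_derivative K s) (at s)" for s
      unfolding K1_def[abs_def] K_def by (intro DERIV_diff DERIV_bdiff H1 H2)
    fix q :: real assume "0 \<le> q" "q \<le> 1"
    \<comment> \<open>Differences commute with averaging, so the first estimate bounds the
      differences of \<open>K\<close>.\<close>
    have "bdiff q K t = bdiff q H t - bdiff 1 (bdiff q H1) t"
      by (simp add: bdiff_def K_def algebra_simps)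
    with 1 show "\<bar>bdiff q K t\<bar> \<le> e"
      using \<open>0 \<le> q\<close> \<open>q \<le> 1\<close> by simp
  qed
  moreover have "K t - bdiff 1 K1 t = H t - 2 * bdiff 1 H1 t + bdiff 1 (bdiff 1 H2) t"
    by (simp add: bdiff_def K_def K1_def algebra_simps)
  ultimately show "\<bar>H t - 2 * bdiff 1 H1 t + bdiff 1 (bdiff 1 H2) t\<bar> \<le> e"
    by simp
qed

text \<open>With \<open>M\<close> the average over a unit interval, \<open>H = (1 - M)\<^sup>2 H + 2 M H - M\<^sup>2 H\<close>, where the first
  term is small and the other two are more regular. Subtracting \<open>(1 - M)\<^sup>2 H\<close> from \<open>x\<close> leaves a
  system whose inputs are again averaged second differences.\<close>

lemma linear_system_tendsto_zero_if_second_differences_vanish: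
  assumes sys: "linear_system a b G (\<lambda>_. 0) x z" and "a > 0" "b > 0"
    and H: "\<And>t. (H has_real_derivative G t) (at t)"
    and van: "second_differences_vanish H"
  shows "(x \<longlongrightarrow> 0) at_top"
proof -
  have cont: "continuous_on UNIV K" if "\<And>t. (K has_real_derivative k t) (at t)" for K k :: "real \<Rightarrow> real"
    by (intro continuous_at_imp_continuous_on ballI DERIV_isCont[OF that])
  obtain H1 where H1: "\<And>t. (H1 has_real_derivative H t) (at t)"
    using antiderivative_real_exists[OF cont[OF H]] by blast
  obtain H2 where H2: "\<And>t. (H2 has_real_derivative H1 t) (at t)"
    using antiderivative_real_exists[OF cont[OF H1]] by blast
  define e1 where "e1 t = H t - 2 * bdiff 1 H1 t + bdiff 1 (bdiff 1 H2) t" for t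
  define e2 where "e2 t = bdiff 1 H t - bdiff 1 (bdiff 1 H1) t" for t
  define e3 where "e3 t = bdiff 1 (bdiff 1 H) t" for t
  have small: "\<forall>\<^sub>F t in at_top. \<bar>e1 t\<bar> \<le> d \<and> \<bar>e2 t\<bar> \<le> d \<and> \<bar>e3 t\<bar> \<le> d" if "d > 0" for d
  proof -
    have "\<forall>\<^sub>F t in at_top. \<forall>p\<in>{0..1}. \<forall>q\<in>{0..1}. \<bar>bdiff p (bdiff q H) t\<bar> \<le> d"
      using van that unfolding second_differences_vanish_def by blast
    then show ?thesis
    proof eventually_elim
      case (elim t)
      then show ?case
        using second_difference_averages[OF H1 H2, of t d] unfolding e1_def e2_def e3_def by simp
    qed
  qed
  have lim: "(k \<longlongrightarrow> 0) at_top" if "\<And>d. d > 0 \<Longrightarrow> \<forall>\<^sub>F t in at_top. \<bar>k t\<bar> \<le> d" for k :: "real \<Rightarrow> real"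
  proof (rule tendstoI)
    fix d :: real assume "d > 0"
    then show "\<forall>\<^sub>F t in at_top. dist (k t) 0 < d"
      using that[of "d / 2"] by (auto elim!: eventually_mono)
  qed
  have e: "(e1 \<longlongrightarrow> 0) at_top" "(e2 \<longlongrightarrow> 0) at_top" "(e3 \<longlongrightarrow> 0) at_top"
    by (rule lim, rule eventually_mono[OF small], assumption, simp)+
  define u where "u t = x t - e1 t" for t
  \<comment> \<open>The derivative of \<open>e1\<close> cancels \<open>G\<close> and leaves
    \<open>2 * bdiff 1 H t - bdiff 1 (bdiff 1 H1) t\<close> in \<open>u'\<close>. Moving one more
    \<open>bdiff 1 (bdiff 1 H1) t\<close> into \<open>p\<close> completes this to
    \<open>2 * e2 t\<close>, at the cost of its derivative \<open>e3\<close> in the second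
    equation.\<close>
  define p where "p t = z t + bdiff 1 (bdiff 1 H1) t" for t
  have sys': "linear_system a b (\<lambda>t. 2 * e2 t - a * e1 t) (\<lambda>t. e3 t - b * e1 t) u p"
    unfolding linear_system_def
  proof (intro allI impI conjI)
    fix t :: real assume "t \<ge> 0"
    then have x: "(x has_real_derivative z t - a * x t + G t) (at t within {0..})"
      and z: "(z has_real_derivative - b * x t + 0) (at t within {0..})"
      using sys unfolding linear_system_def by auto
    have "(e1 has_real_derivative G t - 2 * bdiff 1 H t + bdiff 1 (bdiff 1 H1) t) (at t within {0..})"
      unfolding e1_def[abs_def]
      by (intro DERIV_add DERIV_diff DERIV_cmult has_field_derivative_at_within[OF H]
          has_field_derivative_at_within[OF DERIV_bdiff] DERIV_bdiff H1 H2)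
    from DERIV_diff[OF x this]
    show "(u has_real_derivative p t - a * u t + (2 * e2 t - a * e1 t)) (at t within {0..})"
      unfolding u_def[abs_def] by (rule DERIV_cong) (simp add: p_def e2_def algebra_simps)
    have "(bdiff 1 (bdiff 1 H1) has_real_derivative e3 t) (at t within {0..})"
      unfolding e3_def by (rule has_field_derivative_at_within[OF DERIV_bdiff[OF DERIV_bdiff[OF H1]]])
    from DERIV_add[OF z this]
    show "(p has_real_derivative - b * u t + (e3 t - b * e1 t)) (at t within {0..})"
      unfolding p_def[abs_def] by (rule DERIV_cong) (simp add: u_def algebra_simps)
  qed
  have "((\<lambda>t. 2 * e2 t - a * e1 t) \<longlongrightarrow> 2 * 0 - a * 0) at_top"
    "((\<lambda>t. e3 t - b * e1 t) \<longlongrightarrow> 0 - b * 0) at_top"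
    by (intro tendsto_diff tendsto_mult_left e)+
  then have "(u \<longlongrightarrow> 0) at_top"
    by (intro linear_system_tendsto_zero[OF sys' \<open>a > 0\<close> \<open>b > 0\<close>]) simp_all
  from tendsto_add[OF this e(1)] show ?thesis
    by (simp add: u_def)
qed

lemma second_differences_vanish_if_linear_system_tendsto_zero:
  assumes sys: "linear_system a b G (\<lambda>_. 0) x z" and "a > 0" "b > 0"
    and H: "\<And>t. (H has_real_derivative G t) (at t)"
    and x0: "(x \<longlongrightarrow> 0) at_top"
  shows "second_differences_vanish H"
  unfolding second_differences_vanish_def
proof (intro allI impI)
  fix e :: real assume "e > 0"
  \<comment> \<open>The error budget: four values of \<open>x\<close>, two more with factor
    \<open>a\<close>, and one increment of \<open>z\<close> over a length at most 1 with slope at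
    most \<open>b * d\<close>.\<close>
  define d where "d = e / (4 + 2 * a + b)"
  have "d > 0" using \<open>e > 0\<close> assms by (simp add: d_def)
  then have "\<forall>\<^sub>F t in at_top. \<bar>x t\<bar> < d"
    using x0 by (auto simp: tendsto_iff)
  then obtain T0 where T0: "\<And>t. t \<ge> T0 \<Longrightarrow> \<bar>x t\<bar> < d"
    by (auto simp: eventually_at_top_linorder)
  \<comment> \<open>Starting at 1 or later keeps all arguments positive, where derivatives are
    two-sided.\<close>
  define T where "T = max 1 T0"
  have T: "T \<ge> 1" "\<And>t. t \<ge> T \<Longrightarrow> \<bar>x t\<bar> \<le> d"
    by (simp add: T_def) (rule less_imp_le, rule T0, simp add: T_def)
  have at: "at t within {0..} = at t" if "t > 0" for t :: real
    by (rule at_within_interior) (use that in simp)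
  have x': "(x has_real_derivative z t - a * x t + G t) (at t)"
    and z': "(z has_real_derivative - b * x t) (at t)" if "t > 0" for t
    using sys[unfolded linear_system_def, rule_format, of t] that unfolding at[OF that] by simp_all
  have dz: "\<bar>bdiff p z s\<bar> \<le> b * d" if "0 \<le> p" "p \<le> 1" "s - p \<ge> T" for p s
  proof -
    have "norm (z s - z (s - p)) \<le> (b * d) * norm (s - (s - p))"
    proof (rule field_differentiable_bound[of "{s - p..s}"])
      fix r assume "r \<in> {s - p..s}"
      then have r: "r \<ge> T" using that by auto
      then show "(z has_real_derivative - b * x r) (at r within {s - p..s})"
        using T(1) by (intro has_field_derivative_at_within[OF z']) auto
      show "norm (- b * x r) \<le> b * d"
        using T(2)[OF r] \<open>b > 0\<close> by (simp add: abs_mult)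
    qed (use that in auto)
    also have "\<dots> \<le> (b * d) * 1"
      using that \<open>b > 0\<close> \<open>d > 0\<close> by (intro mult_left_mono) auto
    finally show ?thesis by (simp add: bdiff_def)
  qed
  \<comment> \<open>From \<open>T + 2\<close> on, two shifts of at most 1 keep the arguments at or
    above \<open>T\<close>.\<close>
  have "\<bar>bdiff p (bdiff q H) t\<bar> \<le> e" if t: "t \<ge> T + 2" and p: "0 \<le> p" "p \<le> 1" and q: "0 \<le> q" "q \<le> 1" for t p q
  proof -
    define K where "K s = H s - x s" for s
    have K': "(K has_real_derivative a * x s - z s) (at s)" if "s > 0" for s
      unfolding K_def[abs_def]
      by (rule DERIV_cong[OF DERIV_diff[OF H x'[OF that]]]) simp
    \<comment> \<open>The mean value theorem is applied in the outer shift. In the derivative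
      \<open>z\<close> occurs only through \<open>bdiff q z\<close>, which is small because
      \<open>z' = - b * x\<close> is.\<close>
    define g where "g \<theta> = bdiff q K (t - \<theta>)" for \<theta>
    have "norm (g p - g 0) \<le> (2 * a * d + b * d) * norm (p - 0)"
    proof (rule field_differentiable_bound[of "{0..1}"])
      fix \<theta> :: real assume \<theta>: "\<theta> \<in> {0..1}"
      have sh: "((\<lambda>\<theta>. K (t - \<theta> - r)) has_real_derivative - (a * x (t - \<theta> - r) - z (t - \<theta> - r))) (at \<theta> within {0..1})"
        if "0 \<le> r" "r \<le> 1" for r
      proof -
        have "((\<lambda>\<theta>. t - \<theta> - r) has_real_derivative - 1) (at \<theta> within {0..1})"
          by (auto intro!: derivative_eq_intros)
        from DERIV_chain2[OF K' this] show ?thesis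
          using that \<theta> t T(1) by simp
      qed
      have "(g has_real_derivative - (a * x (t - \<theta>) - z (t - \<theta>)) - - (a * x (t - \<theta> - q) - z (t - \<theta> - q))) (at \<theta> within {0..1})"
        unfolding g_def[abs_def] bdiff_def
        using DERIV_diff[OF sh[of 0] sh[OF q]] by simp
      then show "(g has_real_derivative bdiff q z (t - \<theta>) - a * (x (t - \<theta>) - x (t - \<theta> - q))) (at \<theta> within {0..1})"
        by (rule DERIV_cong) (simp add: bdiff_def algebra_simps)
      have "\<bar>x (t - \<theta>) - x (t - \<theta> - q)\<bar> \<le> 2 * d"
        using T(2)[of "t - \<theta>"] T(2)[of "t - \<theta> - q"] \<theta> t q by auto
      then have "a * \<bar>x (t - \<theta>) - x (t - \<theta> - q)\<bar> \<le> a * (2 * d)"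
        using \<open>a > 0\<close> by (intro mult_left_mono) auto
      then have "\<bar>a * (x (t - \<theta>) - x (t - \<theta> - q))\<bar> \<le> 2 * a * d"
        using \<open>a > 0\<close> by (simp add: abs_mult)
      moreover have "\<bar>bdiff q z (t - \<theta>)\<bar> \<le> b * d"
        using \<theta> t q by (intro dz) auto
      ultimately show "norm (bdiff q z (t - \<theta>) - a * (x (t - \<theta>) - x (t - \<theta> - q))) \<le> 2 * a * d + b * d"
        unfolding real_norm_def by linarith
    qed (use p in auto)
    also have "\<dots> \<le> (2 * a * d + b * d) * 1"
      using p assms(2,3) \<open>d > 0\<close> by (intro mult_left_mono) auto
    finally have 1: "\<bar>bdiff p (bdiff q K) t\<bar> \<le> 2 * a * d + b * d"
      by (simp add: g_def bdiff_def)
    have 2: "\<bar>bdiff p (bdiff q x) t\<bar> \<le> 4 * d"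
      using T(2)[of t] T(2)[of "t - p"] T(2)[of "t - q"] T(2)[of "t - p - q"] t p q
      unfolding bdiff_def by linarith
    have "bdiff p (bdiff q H) t = bdiff p (bdiff q K) t + bdiff p (bdiff q x) t"
      by (simp add: bdiff_def K_def)
    then have "\<bar>bdiff p (bdiff q H) t\<bar> \<le> d * (4 + 2 * a + b)"
      using 1 2 by (simp add: algebra_simps)
    also have "\<dots> = e"
      using assms(2,3) by (simp add: d_def)
    finally show ?thesis .
  qed
  then show "\<forall>\<^sub>F t in at_top. \<forall>p\<in>{0..1}. \<forall>q\<in>{0..1}. \<bar>bdiff p (bdiff q H) t\<bar> \<le> e"
    unfolding eventually_at_top_linorder by (intro exI[of _ "T + 2"]) auto
qed

text \<open>The argument of the uniform convergence theorem for slowly varying functions: by Baire, the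
  differences are uniformly small for increments in some interval \<open>[\<alpha>, \<beta>]\<close>, hence for
  increments in \<open>[0, \<beta> - \<alpha>]\<close>, and finitely many translates of the latter cover \<open>[0, 1]\<close>.\<close>

lemma uniform_differences_if_pointwise:
  fixes K :: "real \<Rightarrow> 'q \<Rightarrow> real"
  assumes cont: "\<And>q. q \<in> Q \<Longrightarrow> continuous_on UNIV (\<lambda>t. K t q)"
    and ptw: "\<And>p e. 0 \<le> p \<Longrightarrow> p \<le> 1 \<Longrightarrow> e > 0 \<Longrightarrow> \<forall>\<^sub>F t in at_top. \<forall>q\<in>Q. \<bar>K t q - K (t - p) q\<bar> \<le> e"
    and "e > 0"
  shows "\<forall>\<^sub>F t in at_top. \<forall>p\<in>{0..1}. \<forall>q\<in>Q. \<bar>K t q - K (t - p) q\<bar> \<le> e"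
proof -
  \<comment> \<open>One \<open>d\<close> is spent on a grid point and \<open>2 * d\<close> on the
    remaining shift.\<close>
  define d where "d = e / 3"
  have "d > 0" using \<open>e > 0\<close> by (simp add: d_def)
  define E where "E n = {p \<in> {0..1}. \<forall>t\<ge>real n. \<forall>q\<in>Q. \<bar>K t q - K (t - p) q\<bar> \<le> d}" for n
  have E_bound: "\<bar>K t q - K (t - p) q\<bar> \<le> d" if "p \<in> E n" "real n \<le> t" "q \<in> Q" for p n t q
    using that by (simp add: E_def)
  have closed_E: "closed (E n)" for n
  proof -
    have "E n = {0..1} \<inter> (\<Inter>t\<in>{real n..}. \<Inter>q\<in>Q. {p. \<bar>K t q - K (t - p) q\<bar> \<le> d})"
      by (auto simp: E_def)
    moreover have "closed {p. \<bar>K t q - K (t - p) q\<bar> \<le> d}" if "q \<in> Q" for t q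
      by (intro closed_Collect_le continuous_intros continuous_on_compose2[OF cont[OF that]]) auto
    ultimately show ?thesis by (simp add: closed_Int closed_INT)
  qed
  have cover: "\<exists>n. p \<in> E n" if p: "p \<in> {0..1}" for p
  proof -
    obtain T where T: "\<And>t. t \<ge> T \<Longrightarrow> \<forall>q\<in>Q. \<bar>K t q - K (t - p) q\<bar> \<le> d"
      using ptw[of p d] p \<open>d > 0\<close> unfolding eventually_at_top_linorder by fastforce
    obtain n where "T \<le> real n" using real_arch_simple by blast
    with T p have "p \<in> E n" by (simp add: E_def)
    then show ?thesis ..
  qed
  \<comment> \<open>Otherwise the complements of the closed sets \<open>E n\<close> would all be
    open and dense in \<open>{0..1}\<close>, and their intersection, which is empty by
    \<open>cover\<close>, would be dense too.\<close>
  have "\<exists>n. \<not> {0..1} \<subseteq> closure ({0..1} - E n)"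
  proof (rule ccontr)
    assume "\<not> ?thesis"
    then have "{0..1::real} \<subseteq> closure (\<Inter>(range (\<lambda>n. {0..1} - E n)))"
      using closed_E by (intro Baire) (auto intro!: openin_diff closed_subset simp: E_def)
    moreover have "\<Inter>(range (\<lambda>n. {0..1} - E n)) = {}"
      using cover by blast
    ultimately have "{0..1::real} \<subseteq> {}"
      by (simp only: closure_empty)
    then show False by simp
  qed
  then obtain n y where y: "y \<in> {0..1}" "y \<notin> closure ({0..1} - E n)"
    by blast
  then obtain r where r: "r > 0" "\<And>p. p \<in> {0..1} \<Longrightarrow> dist p y < r \<Longrightarrow> p \<in> E n"
    unfolding closure_approachable by blast
  define \<alpha> \<beta> where "\<alpha> = max 0 (y - r / 2)" and "\<beta> = min 1 (y + r / 2)"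
  have \<alpha>\<beta>: "0 \<le> \<alpha>" "\<alpha> < \<beta>" "\<beta> \<le> 1"
    using y(1) r(1) by (auto simp: \<alpha>_def \<beta>_def)
  have in_E: "p \<in> E n" if "\<alpha> \<le> p" "p \<le> \<beta>" for p
    using that r(1) by (intro r(2)) (auto simp: \<alpha>_def \<beta>_def dist_real_def)
  define \<delta> where "\<delta> = \<beta> - \<alpha>"
  have "\<delta> > 0" using \<alpha>\<beta> by (simp add: \<delta>_def)
  \<comment> \<open>Both \<open>s\<close> and \<open>s - h\<close> are compared with
    \<open>s + \<alpha>\<close>, the increments being \<open>\<alpha>\<close> and
    \<open>\<alpha> + h\<close>.\<close>
  have near: "\<bar>K s q - K (s - h) q\<bar> \<le> 2 * d" if "s \<ge> real n" "0 \<le> h" "h \<le> \<delta>" "q \<in> Q" for s h q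
  proof -
    have "\<alpha> \<in> E n" "\<alpha> + h \<in> E n"
      using that \<alpha>\<beta> by (auto intro!: in_E simp: \<delta>_def)
    then have "\<bar>K (s + \<alpha>) q - K (s + \<alpha> - \<alpha>) q\<bar> \<le> d" "\<bar>K (s + \<alpha>) q - K (s + \<alpha> - (\<alpha> + h)) q\<bar> \<le> d"
      using that \<alpha>\<beta>(1) by (intro E_bound[of _ n]; simp)+
    moreover have "s + \<alpha> - \<alpha> = s" "s + \<alpha> - (\<alpha> + h) = s - h" by simp_all
    ultimately show ?thesis by simp
  qed
  \<comment> \<open>A finite grid of multiples of \<open>\<delta>\<close>: every \<open>p\<close> in
    \<open>{0..1}\<close> exceeds one of them by at most \<open>\<delta>\<close>.\<close>
  define J where "J = {j::nat. real j * \<delta> \<le> 1}"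
  have "finite J"
  proof -
    have "j \<le> nat \<lceil>1 / \<delta>\<rceil>" if "j \<in> J" for j
    proof -
      have "real j \<le> 1 / \<delta>"
        using that \<open>\<delta> > 0\<close> by (simp add: J_def field_simps)
      then show ?thesis by linarith
    qed
    then show ?thesis
      by (meson finite_nat_set_iff_bounded_le)
  qed
  then have "\<forall>\<^sub>F t in at_top. \<forall>j\<in>J. \<forall>q\<in>Q. \<bar>K t q - K (t - real j * \<delta>) q\<bar> \<le> d"
    using \<open>\<delta> > 0\<close> \<open>d > 0\<close> by (intro eventually_ball_finite ballI ptw) (auto simp: J_def)
  with eventually_ge_at_top[of "real n + 1"] show ?thesis
  proof eventually_elim
    case (elim t)
    show ?case
    proof (intro ballI)
      fix p q assume p: "p \<in> {0..1::real}" and q: "q \<in> Q"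
      define j where "j = nat \<lfloor>p / \<delta>\<rfloor>"
      have fl: "real j = of_int \<lfloor>p / \<delta>\<rfloor>"
        using p \<open>\<delta> > 0\<close> by (simp add: j_def)
      have "real j \<le> p / \<delta>" "p / \<delta> \<le> real j + 1"
        unfolding fl by linarith+
      then have j: "real j * \<delta> \<le> p" "p \<le> real j * \<delta> + \<delta>"
        using \<open>\<delta> > 0\<close> by (auto simp: field_simps)
      then have "j \<in> J" using p by (auto simp: J_def)
      then have "\<bar>K t q - K (t - real j * \<delta>) q\<bar> \<le> d"
        using elim(2) q by blast
      moreover have "\<bar>K (t - real j * \<delta>) q - K (t - real j * \<delta> - (p - real j * \<delta>)) q\<bar> \<le> 2 * d"
        using j p elim(1) q by (intro near) auto
      moreover have "t - real j * \<delta> - (p - real j * \<delta>) = t - p" "e = 3 * d"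
        by (simp_all add: d_def)
      ultimately show "\<bar>K t q - K (t - p) q\<bar> \<le> e"
        by (smt (verit))
    qed
  qed
qed

text \<open>The uniformity theorem is applied twice: for fixed \<open>p\<close>, with a one-point
  parameter set, it gives uniformity in \<open>q\<close>; then \<open>q\<close> becomes the
  parameter and uniformity in \<open>p\<close> follows as well.\<close>

lemma second_differences_vanish_if_pointwise:
  assumes cont: "continuous_on UNIV H"
    and ptw: "\<And>p q. 0 \<le> p \<Longrightarrow> p \<le> 1 \<Longrightarrow> 0 \<le> q \<Longrightarrow> q \<le> 1 \<Longrightarrow> (bdiff p (bdiff q H) \<longlongrightarrow> 0) at_top"
  shows "second_differences_vanish H"
proof -
  have cont_bdiff: "continuous_on UNIV (bdiff p H)" for p
    unfolding bdiff_def[abs_def] by (intro continuous_intros continuous_on_compose2[OF cont]) auto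
  have 1: "\<forall>\<^sub>F t in at_top. \<forall>q\<in>{0..1}. \<bar>bdiff q (bdiff p H) t\<bar> \<le> e"
    if p: "0 \<le> p" "p \<le> 1" and "e > 0" for p e :: real
  proof -
    have "\<forall>\<^sub>F t in at_top. \<forall>q\<in>{0..1}. \<forall>u\<in>UNIV::unit set. \<bar>bdiff p H t - bdiff p H (t - q)\<bar> \<le> e"
    proof (rule uniform_differences_if_pointwise[where Q = UNIV and K = "\<lambda>t u. bdiff p H t"])
      fix q e :: real assume "0 \<le> q" "q \<le> 1" "e > 0"
      then have "\<forall>\<^sub>F t in at_top. \<bar>bdiff q (bdiff p H) t\<bar> < e"
        using ptw[of q p] p by (auto simp: tendsto_iff)
      then show "\<forall>\<^sub>F t in at_top. \<forall>u\<in>UNIV::unit set. \<bar>bdiff p H t - bdiff p H (t - q)\<bar> \<le> e"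
        by eventually_elim (auto simp: bdiff_def)
    qed (use cont_bdiff \<open>e > 0\<close> in auto)
    then show ?thesis
      by eventually_elim (auto simp: bdiff_def)
  qed
  have "\<forall>\<^sub>F t in at_top. \<forall>p\<in>{0..1}. \<forall>q\<in>{0..1}. \<bar>bdiff q H t - bdiff q H (t - p)\<bar> \<le> e" if "e > 0" for e
  proof (rule uniform_differences_if_pointwise)
    fix p e :: real assume "0 \<le> p" "p \<le> 1" "e > 0"
    from 1[OF this] show "\<forall>\<^sub>F t in at_top. \<forall>q\<in>{0..1}. \<bar>bdiff q H t - bdiff q H (t - p)\<bar> \<le> e"
      unfolding bdiff_commute[of _ p] by (simp add: bdiff_def[of p])
  qed (use cont_bdiff that in auto)
  then show ?thesis
    unfolding second_differences_vanish_def by (simp add: bdiff_def[of _ "bdiff _ H"])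
qed

section \<open>The differential equation as a linear system\<close>

lemma linear_system_cong:
  assumes "linear_system a b g h u p" "\<And>t. t \<ge> 0 \<Longrightarrow> u t = u' t"
  shows "linear_system a b g h u' p"
  unfolding linear_system_def
proof (intro allI impI conjI)
  fix t :: real assume t: "t \<ge> 0"
  then have u: "(u has_real_derivative p t - a * u t + g t) (at t within {0..})"
    and p: "(p has_real_derivative - b * u t + h t) (at t within {0..})"
    using assms(1) unfolding linear_system_def by blast+
  show "(u' has_real_derivative p t - a * u' t + g t) (at t within {0..})"
    using has_field_derivative_transform_within[OF u zero_less_one, of u'] t assms(2) by simp
  show "(p has_real_derivative - b * u' t + h t) (at t within {0..})"
    using p assms(2)[OF t] by simp
qed

text \<open>Substituting \<open>z = x' + a x - primitive f\<close> removes the discontinuous right-hand side.\<close>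

lemma linear_system_if_is_ode_solution:
  assumes f: "L1_loc f" and sol: "is_ode_solution a b f \<xi>0 \<xi>1 x"
  obtains z where "linear_system a b (primitive f) (\<lambda>_. 0) x z" "x 0 = \<xi>0" "z 0 = \<xi>1 + a * \<xi>0"
proof -
  obtain v where x: "\<And>t. t \<ge> 0 \<Longrightarrow> (x has_real_derivative v t) (at t within {0..})"
    and v: "continuous_on {0..} v" "locally_abs_continuous v"
    and AE: "AE t in lebesgue. t \<ge> 0 \<longrightarrow>
             (\<exists>w. (v has_real_derivative w) (at t within {0..}) \<and> w + a * v t + b * x t = f t)"
    and init: "x 0 = \<xi>0" "v 0 = \<xi>1"
    using sol unfolding is_ode_solution_def by blast
  define z where "z t = v t + a * x t - primitive f t" for t
  have cx: "continuous_on {0..} x"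
    using x by (intro DERIV_continuous_on) auto
  \<comment> \<open>\<open>x\<close> is continued to the left by its initial value, so that it has
    an antiderivative on the line.\<close>
  have "continuous_on UNIV (\<lambda>t. x (max 0 t))"
    by (rule continuous_on_compose2[OF cx]) (auto intro!: continuous_intros)
  then obtain X where X: "\<And>t. (X has_real_derivative x (max 0 t)) (at t)"
    using antiderivative_real_exists by blast
  define C where "C t = a * x t + b * X t" for t
  \<comment> \<open>By the equation \<open>W\<close> has derivative zero almost everywhere, hence is
    constant. This makes \<open>z\<close> equal to a constant minus \<open>b * X\<close>, so
    \<open>z\<close> is differentiable at every point although \<open>v\<close> need not be.\<close>
  define W where "W t = v t + C t - primitive f t" for t
  have C: "(C has_real_derivative a * v t + b * x t) (at t within {0..})" if "t \<ge> 0" for t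
    using DERIV_add[OF DERIV_cmult[OF x[OF that], of a] DERIV_cmult[OF has_field_derivative_at_within[OF X], of b t "{0..}"]] that
    unfolding C_def[abs_def] by (simp add: max_def)
  obtain N1 where N1: "negligible N1"
    "\<And>t. t \<ge> 0 \<Longrightarrow> t \<notin> N1 \<Longrightarrow> (primitive f has_real_derivative f t) (at t within {0..})"
    using primitive_has_derivative_AE[OF f] by blast
  obtain N2 where N2: "N2 \<in> null_sets lebesgue"
    "\<And>t. t \<notin> N2 \<Longrightarrow> t \<ge> 0 \<Longrightarrow> \<exists>w. (v has_real_derivative w) (at t within {0..}) \<and> w + a * v t + b * x t = f t"
    using AE_E3[OF AE] by auto
  have W0: "W t = W 0" if "t \<ge> 0" for t
  proof (rule abs_continuous_zero_derivative[OF _ that])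
    show "abs_continuous_on_interval 0 t W"
      unfolding W_def[abs_def]
    proof (intro abs_continuous_on_interval_diff abs_continuous_on_interval_add abs_continuous_primitive f)
      show "abs_continuous_on_interval 0 t v"
        using v(2) that by (auto simp: locally_abs_continuous_def)
      show "abs_continuous_on_interval 0 t C"
      proof (rule abs_continuous_on_interval_C1)
        show "(C has_real_derivative a * v s + b * x s) (at s within {0..t})" if "s \<in> {0..t}" for s
          by (rule DERIV_subset[OF C]) (use that in auto)
        show "continuous_on {0..t} (\<lambda>s. a * v s + b * x s)"
          by (intro continuous_intros continuous_on_subset[OF v(1)] continuous_on_subset[OF cx]) auto
      qed
    qed
    show "negligible (N1 \<union> N2)"
      using N1(1) N2(1) by (simp add: negligible_iff_null_sets null_sets.Un)
    fix s assume s: "s \<in> {0..t} - (N1 \<union> N2)"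
    then obtain w where w: "(v has_real_derivative w) (at s within {0..})" "w + a * v s + b * x s = f s"
      using N2(2)[of s] by auto
    have "(W has_real_derivative w + (a * v s + b * x s) - f s) (at s within {0..})"
      unfolding W_def[abs_def] using s by (intro DERIV_diff DERIV_add w(1) C N1(2)) auto
    then have "(W has_real_derivative 0) (at s within {0..})"
      unfolding w(2)[symmetric] by (simp add: algebra_simps)
    then show "(W has_real_derivative 0) (at s within {0..t})"
      by (rule DERIV_subset) auto
  qed
  have zX: "z t = W 0 - b * X t" if "t \<ge> 0" for t
    using W0[OF that] by (simp add: z_def W_def C_def)
  show ?thesis
  proof (rule that)
    show "linear_system a b (primitive f) (\<lambda>_. 0) x z"
      unfolding linear_system_def
    proof (intro allI impI conjI)
      fix t :: real assume t: "t \<ge> 0"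
      show "(x has_real_derivative z t - a * x t + primitive f t) (at t within {0..})"
        using x[OF t] by (simp add: z_def)
      have "((\<lambda>t. W 0 - b * X t) has_real_derivative 0 - b * x t) (at t within {0..})"
      proof (rule has_field_derivative_at_within[OF DERIV_diff[OF DERIV_const]])
        show "((\<lambda>t. b * X t) has_real_derivative b * x t) (at t)"
          using DERIV_cmult[OF X, of b t] t by (simp add: max_def)
      qed
      from has_field_derivative_transform_within[OF this zero_less_one, of z]
      show "(z has_real_derivative - b * x t + 0) (at t within {0..})"
        using t zX by simp
    qed
  qed (use init in \<open>simp_all add: z_def\<close>)
qed

text \<open>In \<open>v = C + primitive f\<close> the summand \<open>C\<close> is continuously
  differentiable, so absolute continuity and the derivative almost everywhere come from the
  primitive. As \<open>primitive f 0 = 0\<close>, the initial velocity is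
  \<open>\<xi>1\<close>.\<close>

lemma is_ode_solution_if_linear_system:
  assumes f: "L1_loc f" and sys: "linear_system a b (primitive f) (\<lambda>_. 0) x z"
    and init: "x 0 = \<xi>0" "z 0 = \<xi>1 + a * \<xi>0"
  shows "is_ode_solution a b f \<xi>0 \<xi>1 x"
proof -
  define C where "C t = z t - a * x t" for t
  define v where "v t = C t + primitive f t" for t
  have x: "(x has_real_derivative v t) (at t within {0..})"
    and z: "(z has_real_derivative - b * x t) (at t within {0..})" if "t \<ge> 0" for t
    using sys that by (auto simp: linear_system_def v_def C_def)
  have C: "(C has_real_derivative - b * x t - a * v t) (at t within {0..})" if "t \<ge> 0" for t
    unfolding C_def[abs_def] by (intro DERIV_diff DERIV_cmult x z that)
  have cx: "continuous_on {0..} x"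
    using x by (intro DERIV_continuous_on) auto
  have cv: "continuous_on {0..} v"
    unfolding v_def[abs_def] using C continuous_on_primitive[OF f]
    by (intro continuous_on_add DERIV_continuous_on[of "{0..}" C]) (auto intro: continuous_on_subset)
  have "locally_abs_continuous v"
    unfolding locally_abs_continuous_def v_def[abs_def]
  proof (intro allI impI abs_continuous_on_interval_add abs_continuous_primitive f)
    fix T :: real assume "T \<ge> 0"
    show "abs_continuous_on_interval 0 T C"
    proof (rule abs_continuous_on_interval_C1)
      show "(C has_real_derivative - b * x s - a * v s) (at s within {0..T})" if "s \<in> {0..T}" for s
        by (rule DERIV_subset[OF C]) (use that in auto)
      show "continuous_on {0..T} (\<lambda>s. - b * x s - a * v s)"
        by (intro continuous_intros continuous_on_subset[OF cv] continuous_on_subset[OF cx]) auto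
    qed
  qed
  moreover have "AE t in lebesgue. t \<ge> 0 \<longrightarrow>
     (\<exists>w. (v has_real_derivative w) (at t within {0..}) \<and> w + a * v t + b * x t = f t)"
  proof -
    obtain N where N: "negligible N"
      "\<And>t. t \<ge> 0 \<Longrightarrow> t \<notin> N \<Longrightarrow> (primitive f has_real_derivative f t) (at t within {0..})"
      using primitive_has_derivative_AE[OF f] by blast
    have "(v has_real_derivative - b * x t - a * v t + f t) (at t within {0..})" if "t \<ge> 0" "t \<notin> N" for t
      unfolding v_def[abs_def] using DERIV_add[OF C N(2)] that by (simp add: v_def)
    then have "\<exists>w. (v has_real_derivative w) (at t within {0..}) \<and> w + a * v t + b * x t = f t"
      if "t \<ge> 0" "t \<notin> N" for t
      using that by (intro exI[of _ "- b * x t - a * v t + f t"]) simp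
    moreover have "N \<in> null_sets lebesgue"
      using N(1) by (simp add: negligible_iff_null_sets)
    ultimately show ?thesis
      by (intro AE_I'[of N]) auto
  qed
  ultimately show ?thesis
    unfolding is_ode_solution_def using x cv init
    by (intro exI[of _ v]) (auto simp: v_def C_def)
qed

text \<open>A solution of the system is restricted to \<open>{0..}\<close>; uniqueness for the
  system shows that the definite description denotes it.\<close>

lemma linear_system_ode_solution:
  assumes f: "L1_loc f" and "a > 0" "b > 0"
  obtains z where "linear_system a b (primitive f) (\<lambda>_. 0) (ode_solution a b f \<xi>0 \<xi>1) z"
proof -
  have "continuous_on {0..} (primitive f)"
    using continuous_on_primitive[OF f] by (rule continuous_on_subset) auto
  then obtain u p where u: "linear_system a b (primitive f) (\<lambda>_. 0) u p" "u 0 = \<xi>0" "p 0 = \<xi>1 + a * \<xi>0"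
    using linear_system_exists[OF _ continuous_on_const assms(2,3)] by metis
  define x where "x = restrict u {0..}"
  have sys: "linear_system a b (primitive f) (\<lambda>_. 0) x p"
    by (rule linear_system_cong[OF u(1)]) (simp add: x_def)
  have "x \<in> extensional {0..}"
    by (simp add: x_def)
  moreover have "is_ode_solution a b f \<xi>0 \<xi>1 x"
    using is_ode_solution_if_linear_system[OF f sys] u(2,3) by (simp add: x_def)
  moreover have "y = x" if y: "y \<in> extensional {0..}" "is_ode_solution a b f \<xi>0 \<xi>1 y" for y
  proof -
    obtain z where z: "linear_system a b (primitive f) (\<lambda>_. 0) y z" "y 0 = \<xi>0" "z 0 = \<xi>1 + a * \<xi>0"
      using linear_system_if_is_ode_solution[OF f y(2)] by blast
    show ?thesis
    proof (rule extensionalityI[OF y(1) \<open>x \<in> extensional {0..}\<close>])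
      show "y t = x t" if "t \<in> {0..}" for t
        using linear_system_unique[OF z(1) sys assms(2,3)] z(2,3) u(2,3) that by (simp add: x_def)
    qed
  qed
  ultimately have "ode_solution a b f \<xi>0 \<xi>1 = x"
    unfolding ode_solution_def by (intro the_equality conjI) blast+
  with sys that show ?thesis by simp
qed

text \<open>The kernel \<open>t * exp (- t)\<close> is the fundamental solution for the double root
  -1. Integration by parts expresses \<open>y2 f\<close> through \<open>primitive f\<close>, and the
  system is then checked by differentiation.\<close>

lemma linear_system_y2:
  assumes f: "L1_loc f"
  obtains z where "linear_system 2 1 (primitive f) (\<lambda>_. 0) (y2 f) z"
proof -
  note cG = continuous_on_primitive[OF f]
  have "continuous_on UNIV (\<lambda>s. exp s * primitive f s)"
    by (intro continuous_intros cG)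
  then obtain P where P: "\<And>t. (P has_real_derivative exp t * primitive f t) (at t)"
    using antiderivative_real_exists by blast
  have "continuous_on UNIV (\<lambda>s. (1 + s) * exp s * primitive f s)"
    by (intro continuous_intros cG)
  then obtain Q where Q: "\<And>t. (Q has_real_derivative (1 + t) * exp t * primitive f t) (at t)"
    using antiderivative_real_exists by blast
  \<comment> \<open>This is the integral of
    \<open>(1 + s - t) * exp (- (t - s)) * primitive f s\<close> over \<open>s\<close> in
    \<open>{0..t}\<close>, expanded to separate \<open>t\<close> from \<open>s\<close>.\<close>
  define y where "y t = exp (- t) * (Q t - Q 0 - t * (P t - P 0))" for t
  define z where "z t = y t - exp (- t) * (P t - P 0)" for t
  have y_eq: "y2 f t = y t" if "t \<ge> 0" for t
  proof -
    \<comment> \<open>Here \<open>t\<close> is frozen and \<open>s\<close> varies;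
      \<open>\<phi>\<close> vanishes at \<open>s = t\<close>, so no boundary term remains.\<close>
    define \<phi> where "\<phi> s = (t - s) * exp (- (t - s))" for s
    define \<phi>' where "\<phi>' s = exp (- t) * (t * exp s - (1 + s) * exp s)" for s
    define K where "K s = exp (- t) * (t * P s - Q s)" for s
    have \<phi>: "(\<phi> has_real_derivative \<phi>' s) (at s)" for s
    proof -
      have "exp (- (t - s)) = exp (- t) * exp s"
        by (simp add: exp_add[symmetric])
      then show ?thesis
        unfolding \<phi>_def[abs_def] \<phi>'_def
        by (auto intro!: derivative_eq_intros simp: algebra_simps)
    qed
    have c\<phi>: "continuous_on UNIV \<phi>" and c\<phi>': "continuous_on UNIV \<phi>'"
      unfolding \<phi>_def[abs_def] \<phi>'_def[abs_def] by (intro continuous_intros)+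
    have K: "(K has_real_derivative \<phi>' s * primitive f s) (at s)" for s
      unfolding K_def[abs_def]
      by (rule DERIV_cong[OF DERIV_cmult[OF DERIV_diff[OF DERIV_cmult[OF P] Q]]])
        (simp add: \<phi>'_def algebra_simps)
    have "set_integrable lebesgue {0..t} (\<lambda>s. \<phi> s * f s)"
      by (rule L1_loc_set_integrable[OF L1_loc_continuous_mult[OF f c\<phi>]]) auto
    then have "y2 f t = primitive (\<lambda>s. \<phi> s * f s) t"
      unfolding y2_def primitive_def \<phi>_def by (rule set_lebesgue_integral_eq_integral)
    also have "\<dots> = \<phi> t * primitive f t - (K t - K 0)"
      by (rule primitive_by_parts[OF f \<phi> c\<phi>' K that])
    also have "\<dots> = y t"
      by (simp add: \<phi>_def K_def y_def algebra_simps)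
    finally show ?thesis .
  qed
  have "linear_system 2 1 (primitive f) (\<lambda>_. 0) y z"
    unfolding linear_system_def
  proof (intro allI impI conjI)
    fix t :: real assume "t \<ge> 0"
    have ee: "exp (- t) * exp t = 1" by (simp add: exp_minus)
    have E: "((\<lambda>t. exp (- t)) has_real_derivative - exp (- t)) (at t)"
      by (auto intro!: derivative_eq_intros)
    have P': "((\<lambda>t. P t - P 0) has_real_derivative exp t * primitive f t) (at t)"
      using DERIV_diff[OF P DERIV_const] by simp
    have Q': "((\<lambda>t. Q t - Q 0) has_real_derivative (1 + t) * exp t * primitive f t) (at t)"
      using DERIV_diff[OF Q DERIV_const] by simp
    have EP: "((\<lambda>t. exp (- t) * (P t - P 0)) has_real_derivative primitive f t - exp (- t) * (P t - P 0)) (at t)"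
    proof (rule DERIV_cong[OF DERIV_mult[OF E P']])
      have "exp t * primitive f t * exp (- t) = (exp (- t) * exp t) * primitive f t"
        by (simp add: mult_ac)
      then show "- exp (- t) * (P t - P 0) + exp t * primitive f t * exp (- t) = primitive f t - exp (- t) * (P t - P 0)"
        unfolding ee by simp
    qed
    have y': "(y has_real_derivative primitive f t - exp (- t) * (P t - P 0) - y t) (at t)"
      unfolding y_def[abs_def]
    proof (rule DERIV_cong[OF DERIV_mult[OF E DERIV_diff[OF Q' DERIV_mult[OF DERIV_ident P']]]])
      have "((1 + t) * exp t * primitive f t - (1 * (P t - P 0) + exp t * primitive f t * t)) * exp (- t)
        = (exp (- t) * exp t) * primitive f t - exp (- t) * (P t - P 0)"
        by (simp add: algebra_simps)
      then show "- exp (- t) * (Q t - Q 0 - t * (P t - P 0)) +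
          ((1 + t) * exp t * primitive f t - (1 * (P t - P 0) + exp t * primitive f t * t)) * exp (- t)
          = primitive f t - exp (- t) * (P t - P 0) - exp (- t) * (Q t - Q 0 - t * (P t - P 0))"
        unfolding ee by simp
    qed
    show "(y has_real_derivative z t - 2 * y t + primitive f t) (at t within {0..})"
      by (rule has_field_derivative_at_within[OF DERIV_cong[OF y']]) (simp add: z_def)
    show "(z has_real_derivative - 1 * y t + 0) (at t within {0..})"
      unfolding z_def[abs_def]
      by (rule has_field_derivative_at_within[OF DERIV_cong[OF DERIV_diff[OF y' EP]]]) simp
  qed
  then have "linear_system 2 1 (primitive f) (\<lambda>_. 0) (y2 f) z"
    by (rule linear_system_cong) (simp add: y_eq)
  then show ?thesis by (rule that)
qed

text \<open>For \<open>t \<ge> 2\<close> the truncations at 0 are inactive, as both shifts are at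
  most 1, and each integral becomes a backward difference of an antiderivative.\<close>

lemma F_eq_second_difference:
  assumes f: "L1_loc f" and H: "\<And>t. (H has_real_derivative primitive f t) (at t)"
    and "t \<ge> 2" "0 \<le> p" "p \<le> 1" "0 \<le> q" "q \<le> 1"
  shows "F f (p, q) t = bdiff p (bdiff q H) t"
proof -
  have inner: "(LINT u:{max (s - q) 0..s}|lebesgue. f u) = bdiff q (primitive f) s" if "s \<in> {t - p..t}" for s
  proof -
    have s: "0 \<le> s - q" "s - q \<le> s" using that assms by auto
    have "(LINT u:{s - q..s}|lebesgue. f u) = integral {s - q..s} f"
      using s(1) by (intro set_lebesgue_integral_eq_integral L1_loc_set_integrable[OF f, of _ s]) auto
    moreover have "max (s - q) 0 = s - q"
      using s(1) by simp
    ultimately show ?thesis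
      using primitive_diff[OF f s] by (simp add: bdiff_def)
  qed
  have cont: "continuous_on {t - p..t} (bdiff q (primitive f))"
    unfolding bdiff_def[abs_def]
    by (intro continuous_intros continuous_on_compose2[OF continuous_on_primitive[OF f]]) auto
  have "F f (p, q) t = (LINT s:{t - p..t}|lebesgue. LINT u:{max (s - q) 0..s}|lebesgue. f u)"
    using assms by (simp add: F_def max_def)
  also have "\<dots> = (LINT s:{t - p..t}|lebesgue. bdiff q (primitive f) s)"
    using inner by (intro set_lebesgue_integral_cong) auto
  also have "\<dots> = integral {t - p..t} (bdiff q (primitive f))"
    by (intro set_lebesgue_integral_eq_integral absolutely_integrable_continuous_real cont)
  also have "\<dots> = bdiff q H t - bdiff q H (t - p)"
  proof (rule integral_unique, rule fundamental_theorem_of_calculus)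
    show "t - p \<le> t" using assms by simp
    show "(bdiff q H has_vector_derivative bdiff q (primitive f) s) (at s within {t - p..t})" for s
      unfolding has_real_derivative_iff_has_vector_derivative[symmetric]
      by (rule has_field_derivative_at_within[OF DERIV_bdiff[OF H]])
  qed
  finally show ?thesis
    by (simp add: bdiff_def)
qed

section \<open>Equivalence of the four conditions\<close>

theorem theorem1:
  fixes f :: "real \<Rightarrow> real" and a b :: real
  assumes "L1_loc f" and "a > 0" and "b > 0"
  defines "i \<equiv> (\<forall>\<xi>0 \<xi>1. (ode_solution a b f \<xi>0 \<xi>1 \<longlongrightarrow> 0) at_top)"
    and "ii \<equiv> (y2 f \<longlongrightarrow> 0) at_top"
    and "iii \<equiv> uniform_limit ({0..1} \<times> {0..1}) (\<lambda>t \<theta>. F f \<theta> t) (\<lambda>\<theta>. 0) at_top"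
    and "iv \<equiv> (\<forall>\<theta>\<in>{0..1} \<times> {0..1}. (F f \<theta> \<longlongrightarrow> 0) at_top)"
  shows "(i \<longleftrightarrow> ii) \<and> (ii \<longleftrightarrow> iii) \<and> (iii \<longleftrightarrow> iv)"
proof -
  note f = \<open>L1_loc f\<close>
  obtain H where H: "\<And>t. (H has_real_derivative primitive f t) (at t)"
    using antiderivative_real_exists[OF continuous_on_primitive[OF f]] by blast
  \<comment> \<open>The coefficients are generalised here: the same \<open>H\<close> serves for the
    given equation and for \<open>y2 f\<close>, whose coefficients are 2 and 1.\<close>
  have iff: "(x \<longlongrightarrow> 0) at_top \<longleftrightarrow> second_differences_vanish H"
    if "linear_system a b (primitive f) (\<lambda>_. 0) x z" "a > 0" "b > 0" for a b x z
    using linear_system_tendsto_zero_if_second_differences_vanish[OF that H]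
      second_differences_vanish_if_linear_system_tendsto_zero[OF that H] by blast
  have i: "i \<longleftrightarrow> second_differences_vanish H"
  proof -
    \<comment> \<open>The right-hand side is free of the initial values, so a single solution tends
      to zero iff all of them do.\<close>
    have "(ode_solution a b f \<xi>0 \<xi>1 \<longlongrightarrow> 0) at_top \<longleftrightarrow> second_differences_vanish H" for \<xi>0 \<xi>1
      using linear_system_ode_solution[OF assms(1-3)] iff[OF _ assms(2,3)] by metis
    then show ?thesis by (simp add: i_def)
  qed
  obtain z2 where "linear_system 2 1 (primitive f) (\<lambda>_. 0) (y2 f) z2"
    using linear_system_y2[OF f] by blast
  then have ii: "ii \<longleftrightarrow> second_differences_vanish H"
    unfolding ii_def by (rule iff) simp_all
  have F_eq: "\<forall>\<^sub>F t in at_top. \<forall>p\<in>{0..1}. \<forall>q\<in>{0..1}. F f (p, q) t = bdiff p (bdiff q H) t"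
    using eventually_ge_at_top[of 2]
    by eventually_elim (auto intro!: F_eq_second_difference[OF f H])
  have iii_if: iii if van: "second_differences_vanish H"
    unfolding iii_def uniform_limit_iff
  proof (intro allI impI)
    fix e :: real assume "e > 0"
    then have "\<forall>\<^sub>F t in at_top. \<forall>p\<in>{0..1}. \<forall>q\<in>{0..1}. \<bar>bdiff p (bdiff q H) t\<bar> \<le> e / 2"
      using van unfolding second_differences_vanish_def by (meson half_gt_zero)
    with F_eq show "\<forall>\<^sub>F t in at_top. \<forall>\<theta>\<in>{0..1} \<times> {0..1}. dist (F f \<theta> t) 0 < e"
      by eventually_elim (use \<open>e > 0\<close> in fastforce)
  qed
  have iv_if: iv if iii
    unfolding iv_def
    using tendsto_uniform_limitI[OF that[unfolded iii_def]] by blast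
  have van_if: "second_differences_vanish H" if iv
  proof (rule second_differences_vanish_if_pointwise)
    show "continuous_on UNIV H"
      using H by (meson DERIV_isCont continuous_at_imp_continuous_on)
    fix p q :: real assume pq: "0 \<le> p" "p \<le> 1" "0 \<le> q" "q \<le> 1"
    then have "(F f (p, q) \<longlongrightarrow> 0) at_top"
      using \<open>iv\<close> by (simp add: iv_def)
    moreover have "\<forall>\<^sub>F t in at_top. F f (p, q) t = bdiff p (bdiff q H) t"
      using F_eq pq by (auto elim: eventually_mono)
    ultimately show "(bdiff p (bdiff q H) \<longlongrightarrow> 0) at_top"
      by (rule Lim_transform_eventually)
  qed
  show ?thesis
    using i ii iii_if iv_if van_if by blast
qed

end
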